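(* Let $X_n^H:=\log|\det W_n^H|-\mu_n^H$ with $\mu_n^H=\frac12\log2\pi-\frac n2+\frac n2\log n$. Let $\psi_n^H(z)=\mathbb{E}[e^{zX_n^H}]\,e^{-\frac{z^2}4\log(n/2)}$, $\psi^H(z)=\frac{\Gamma(1/2)}{\Gamma((z+1)/2)}\frac{G(1/2)^2}{G((z+1)/2)^2}$, and let $K>0$ be a constant such that $$\left|\log\psi_n^H(i\xi)-\log\psi^H(i\xi)\right|\le K\,\frac{|\xi|+|\xi|^2+|\xi|^3}n\qquad\text{for all integers } n\ge1\text{ and all real }|\xi|\le\tfrac12n^{1/6}.$$ Then for every $n\ge3$ $$d_{Kol}\left(X_n^H\sqrt{\frac2{\log(n/2)}},\,\mathcal N(0,1)\right)\le C\left(\frac1{22},1,(3+K)e^{\frac74+3K}\right)\sqrt{\frac2{\log(n/2)}},$$ where $C(D,v,K_1)=\frac3{2\pi}\left(2^{v-1}\Gamma\left(\frac v2\right)K_1+\frac7D\sqrt{\frac\pi2}\right)$.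
   Context: $W_n^H$ is a random $n\times n$ Hermitian matrix of the Gaussian Unitary Ensemble, normalized so that its eigenvalues have joint density on $\mathbb{R}^n$ proportional to $\prod_{1\le j<k\le n}|\lambda_k-\lambda_j|^2\prod_{k=1}^n e^{-\lambda_k^2/2}$. $G$ is the Barnes $G$-function (entire, $G(1)=1$, $G(z+1)=G(z)\Gamma(z)$, $G(1+z)=(2\pi)^{z/2}e^{-(z+1)z/2}\prod_{j\ge1}\{(1+\frac zj)^j(1+\frac1j)^{z^2/2}e^{-z}\}$). $d_{Kol}(X,Y)=\sup_{x\in\mathbb{R}}|\mathbb{P}[X\le x]-\mathbb{P}[Y\le x]|$ is the Kolmogorov distance. Logarithms are the continuous branches in $\xi$ vanishing at $\xi=0$. *)

theory Defs
  imports
    "HOL-Probability.Probability"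
    "Jordan_Normal_Form.Char_Poly"
    "Jordan_Normal_Form.Schur_Decomposition"
begin

text \<open>
  Both the analysis and the matrix libraries export a \<open>det\<close>; below,
  \<open>Determinant.det\<close> is the determinant of a matrix with explicit dimensions.
\<close>

text \<open>
  The \<open>n\<^sup>2\<close> real coordinates of a Hermitian \<open>n \<times> n\<close> matrix: position \<open>(i, j)\<close> with
  \<open>i \<le> j\<close> holds the real part of that entry, and position \<open>(i, j)\<close> with \<open>j < i\<close> holds the
  imaginary part of the entry \<open>(j, i)\<close> above the diagonal.
\<close>
definition hermitian_coord :: "complex mat \<Rightarrow> nat \<times> nat \<Rightarrow> real" where
  "hermitian_coord A = (\<lambda>(i, j). if i \<le> j then Re (A $$ (i, j)) else Im (A $$ (j, i)))"

text \<open>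
  The Gaussian Unitary Ensemble with scale \<open>s\<close>: the coordinates are independent centred
  Gaussians, of variance \<open>s\<^sup>2\<close> on the diagonal and \<open>s\<^sup>2 / 2\<close> off the diagonal.
\<close>
definition gaussian_hermitian ::
    "'a measure \<Rightarrow> nat \<Rightarrow> real \<Rightarrow> ('a \<Rightarrow> complex mat) \<Rightarrow> bool" where
  "gaussian_hermitian M n s W \<longleftrightarrow>
     (\<forall>\<omega>\<in>space M. W \<omega> \<in> carrier_mat n n \<and> mat_adjoint (W \<omega>) = W \<omega>) \<and>
     prob_space.indep_vars M (\<lambda>_. borel) (\<lambda>p \<omega>. hermitian_coord (W \<omega>) p)
       ({..<n} \<times> {..<n}) \<and>
     (\<forall>i<n. \<forall>j<n. distributed M lborel (\<lambda>\<omega>. hermitian_coord (W \<omega>) (i, j))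
       (normal_density 0 (if i = j then s else s / sqrt 2)))"

definition is_eigenvalue_tuple :: "nat \<Rightarrow> complex mat \<Rightarrow> (nat \<Rightarrow> real) \<Rightarrow> bool" where
  "is_eigenvalue_tuple n A x \<longleftrightarrow> char_poly A = (\<Prod>i<n. [:- complex_of_real (x i), 1:])"

definition perm_invariant :: "nat \<Rightarrow> (nat \<Rightarrow> real) set \<Rightarrow> bool" where
  "perm_invariant n B \<longleftrightarrow> (\<forall>x\<in>B. \<forall>p. p permutes {..<n} \<longrightarrow> x \<circ> p \<in> B)"

text \<open>
  The eigenvalues of \<open>W\<close>, listed with multiplicity and in no particular order, have joint
  density proportional to the symmetric function \<open>\<rho>\<close> on \<open>\<real>\<^sup>n\<close>. Since the
  eigenvalues are unordered, only permutation-invariant events are tested.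
\<close>
definition eigenvalue_density_proportional ::
    "'a measure \<Rightarrow> nat \<Rightarrow> ('a \<Rightarrow> complex mat) \<Rightarrow> ((nat \<Rightarrow> real) \<Rightarrow> real) \<Rightarrow> bool" where
  "eigenvalue_density_proportional M n W \<rho> \<longleftrightarrow>
     (\<exists>c>0. \<forall>B\<in>sets (Pi\<^sub>M {..<n} (\<lambda>_. lborel)). perm_invariant n B \<longrightarrow>
        {\<omega>\<in>space M. \<exists>x\<in>B. is_eigenvalue_tuple n (W \<omega>) x} \<in> sets M \<and>
        emeasure M {\<omega>\<in>space M. \<exists>x\<in>B. is_eigenvalue_tuple n (W \<omega>) x} =
          emeasure (density (Pi\<^sub>M {..<n} (\<lambda>_. lborel)) (\<lambda>x. ennreal (c * \<rho> x))) B)"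

definition GUE_matrix :: "'a measure \<Rightarrow> nat \<Rightarrow> ('a \<Rightarrow> complex mat) \<Rightarrow> bool" where
  "GUE_matrix M n W \<longleftrightarrow> prob_space M \<and> (\<exists>s>0. gaussian_hermitian M n s W) \<and>
     eigenvalue_density_proportional M n W
       (\<lambda>x. (\<Prod>k<n. \<Prod>j<k. \<bar>x k - x j\<bar> ^ 2) * (\<Prod>k<n. exp (- (x k)\<^sup>2 / 2)))"

definition mu_H :: "nat \<Rightarrow> real" where
  "mu_H n = 1 / 2 * ln (2 * pi) - real n / 2 + real n / 2 * ln (real n)"

definition X_H :: "nat \<Rightarrow> ('a \<Rightarrow> complex mat) \<Rightarrow> 'a \<Rightarrow> real" where
  "X_H n W \<omega> = ln (cmod (Determinant.det (W \<omega>))) - mu_H n"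

text \<open>
  The Weierstrass product for \<open>G(1 + w)\<close>, taken at \<open>w = z - 1\<close>; the factor with index
  \<open>j\<close> of the usual product over \<open>j \<ge> 1\<close> appears here at index \<open>j - 1\<close>.
\<close>
definition Barnes_G :: "complex \<Rightarrow> complex" where
  "Barnes_G z = (let w = z - 1 in
     of_real (2 * pi) powr (w / 2) * exp (- ((w + 1) * w / 2)) *
     (\<Prod>j. (1 + w / of_nat (Suc j)) ^ Suc j *
           (1 + 1 / of_nat (Suc j)) powr (w\<^sup>2 / 2) * exp (- w)))"

definition psi_n_H :: "'a measure \<Rightarrow> nat \<Rightarrow> ('a \<Rightarrow> complex mat) \<Rightarrow> complex \<Rightarrow> complex" where
  "psi_n_H M n W z =
     (LINT \<omega>|M. exp (z * of_real (X_H n W \<omega>))) * exp (- (z\<^sup>2 / 4 * of_real (ln (real n / 2))))"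

definition psi_H :: "complex \<Rightarrow> complex" where
  "psi_H z = Gamma (1 / 2) / Gamma ((z + 1) / 2) *
     ((Barnes_G (1 / 2))\<^sup>2 / (Barnes_G ((z + 1) / 2))\<^sup>2)"

text \<open>
  \<open>L\<close> is the continuous branch on \<open>S\<close> of the logarithm of \<open>f\<close> vanishing at \<open>0\<close>. On an
  interval containing \<open>0\<close> there is at most one such function.
\<close>
definition is_log_branch :: "real set \<Rightarrow> (real \<Rightarrow> complex) \<Rightarrow> (real \<Rightarrow> complex) \<Rightarrow> bool" where
  "is_log_branch S f L \<longleftrightarrow> continuous_on S L \<and> L 0 = 0 \<and> (\<forall>\<xi>\<in>S. exp (L \<xi>) = f \<xi>)"

definition kolmogorov_distance :: "real measure \<Rightarrow> real measure \<Rightarrow> real" where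
  "kolmogorov_distance M N = (SUP x. \<bar>cdf M x - cdf N x\<bar>)"

definition C_const :: "real \<Rightarrow> real \<Rightarrow> real \<Rightarrow> real" where
  "C_const D v K1 =
     3 / (2 * pi) * (2 powr (v - 1) * Gamma (v / 2) * K1 + 7 / D * sqrt (pi / 2))"

end

theory Submission
  imports Defs
begin

text \<open>
  Write \<open>s = sqrt (2 / ln (n / 2))\<close>. By the definition of \<open>psi_n_H\<close>, the characteristic function of
  the rescaled variable \<open>X\<^sub>n s\<close> at \<open>t\<close> is \<open>exp (- t\<^sup>2 / 2)\<close>, the one of the normal law, times
  \<open>psi\<^sub>n (\<i> u)\<close> with \<open>u = s t\<close> (\<open>GUE_char\<close>). Hence everything rests on an estimate
  \<open>\<bar>psi\<^sub>n (\<i> u) - 1\<bar> \<le> \<kappa> \<bar>u\<bar>\<close> on a fixed interval, here \<open>\<bar>u\<bar> \<le> 1 / 2\<close>: a smoothing inequality of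
  Berry--Esseen type with cut-off \<open>T = 1 / (2 s)\<close> then bounds the Kolmogorov distance by
  a constant multiple of \<open>\<kappa> s + 1 / T\<close>, which is of order \<open>s\<close>.

  The estimate for \<open>psi\<^sub>n\<close> comes from using the assumed bound twice, for matrices of size \<open>1\<close> and
  of size \<open>n\<close>. Both \<open>psi\<^sub>1\<close> and \<open>psi\<^sub>n\<close> are close to the same limit \<open>psi_H\<close>, so
  \<open>psi\<^sub>n = psi\<^sub>1 exp d\<close> where \<open>\<bar>d\<bar>\<close> is at most a multiple of \<open>K \<bar>u\<bar>\<close> (\<open>psi_n_H_near_1\<close>). A GUE matrix
  of size \<open>1\<close> is a single standard normal number \<open>N\<close>, so that \<open>psi\<^sub>1\<close> is explicit:
  \<open>\<bar>psi\<^sub>1 (\<i> u) - 1\<bar> \<le> 9 / 4 \<bar>u\<bar>\<close> follows from a bound on the expectation of \<open>\<bar>ln \<bar>N\<bar> - mu_H 1\<bar>\<close>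
  (\<open>GUE_1_psi_bound\<close>).

  The smoothing inequality (\<open>kolmogorov_smoothing_inequality\<close>) is obtained by convolving both laws
  with the Fejer kernel. Its Fourier transform is supported in \<open>[-T, T]\<close>, so the convolved
  distribution functions are compared using only the values \<open>\<bar>t\<bar> \<le> T\<close> of the characteristic
  functions; and since one of the laws is Lipschitz while the other distribution function is
  monotone, a large difference at one point persists on an interval to one side of it and is seen
  by the convolution. The numerical constants obtained in this way are well below the ones in
  \<open>C_const\<close> (\<open>constant_comparison\<close>).
\<close>

section \<open>The Fejer kernel\<close>

definition triangle :: "real \<Rightarrow> real \<Rightarrow> real" where
  "triangle T t = max 0 (1 - \<bar>t\<bar> / T)"

text \<open>
  The usual \<open>(1 - cos (T y)) / (pi T y\<^sup>2)\<close>, written through \<open>sinc\<close> so that the value at \<open>0\<close> is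
  the continuous one.
\<close>

definition fejer :: "real \<Rightarrow> real \<Rightarrow> real" where
  "fejer T y = T / (2 * pi) * (sinc (T * y / 2))\<^sup>2"

lemma triangle_nonneg: "0 \<le> triangle T t" by (simp add: triangle_def)

lemma triangle_le_1: "T > 0 \<Longrightarrow> triangle T t \<le> 1" by (simp add: triangle_def)

lemma triangle_eq_0: "T > 0 \<Longrightarrow> \<bar>t\<bar> \<ge> T \<Longrightarrow> triangle T t = 0"
  by (simp add: triangle_def field_simps)

lemma borel_measurable_triangle[measurable]: "triangle T \<in> borel_measurable borel"
  unfolding triangle_def by measurable

lemma borel_measurable_fejer[measurable]: "fejer T \<in> borel_measurable borel"
  unfolding fejer_def by measurable

lemma fejer_nonneg: "T > 0 \<Longrightarrow> 0 \<le> fejer T y"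
  by (simp add: fejer_def)

lemma fejer_le_tail: "T > 0 \<Longrightarrow> y \<noteq> 0 \<Longrightarrow> fejer T y \<le> 2 / (pi * T) * (1 / y\<^sup>2)"
proof -
  assume T: "T > 0" and y: "y \<noteq> 0"
  have "(sin (T * y / 2))\<^sup>2 \<le> 1"
    by (simp add: abs_square_le_1)
  then have "fejer T y \<le> T / (2 * pi) * (1 / (T * y / 2)\<^sup>2)"
    using T y unfolding fejer_def
    by (intro mult_left_mono) (auto simp: power_divide divide_right_mono)
  also have "\<dots> = 2 / (pi * T) * (1 / y\<^sup>2)"
    using T y by (simp add: field_simps power2_eq_square)
  finally show ?thesis .
qed

lemma fejer_le_centre: "T > 0 \<Longrightarrow> fejer T y \<le> T / (2 * pi)"
proof -
  assume T: "T > 0"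
  have "\<bar>sinc (T * y / 2)\<bar> \<le> 1"
    using abs_sin_x_le_abs_x[of "T * y / 2"] by (auto simp: divide_le_eq_1)
  then have "(sinc (T * y / 2))\<^sup>2 \<le> 1"
    by (simp only: abs_square_le_1)
  then show ?thesis
    using T unfolding fejer_def by (intro mult_right_le_one_le[THEN order_trans] ) auto
qed

text \<open>
  On the central interval the argument of \<open>sinc\<close> stays in \<open>[-1, 1]\<close>, where
  \<open>sin r \<ge> r - r ^ 3 / 6\<close> gives \<open>sinc \<ge> 5 / 6\<close>.
\<close>

lemma fejer_ge_centre:
  assumes T: "T > 0" and y: "\<bar>y\<bar> \<le> 2 / T"
  shows "T / (2 * pi) * (25 / 36) \<le> fejer T y"
proof -
  define s where "s = T * y / 2"
  have s: "\<bar>s\<bar> \<le> 1" using T y by (simp add: s_def abs_mult field_simps)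
  have sn: "5 / 6 \<le> sin r / r" if r: "0 < r" "r \<le> 1" for r :: real
  proof -
    have sum: "(\<Sum>m<3. sin_coeff m * r ^ m) = r"
      by (simp add: sin_coeff_def numeral_3_eq_3)
    have f3: "fact 3 = (6 :: real)"
      by (simp add: fact_numeral)
    have "\<bar>sin r - r\<bar> \<le> inverse 6 * \<bar>r\<bar> ^ 3"
      using Maclaurin_sin_bound[of r 3] unfolding sum f3 .
    then have "\<bar>sin r - r\<bar> \<le> r ^ 3 / 6"
      using r by simp
    then have "r - r ^ 3 / 6 \<le> sin r"
      by linarith
    moreover have "r ^ 3 \<le> r"
      using power_decreasing[of 1 3 r] r by simp
    ultimately show ?thesis using r by (simp add: field_simps)
  qed
  have "5 / 6 \<le> sinc s"
    using sn[of s] sn[of "-s"] s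
    by (cases s "0 :: real" rule: linorder_cases) (auto simp: abs_le_iff)
  then have "(5/6)\<^sup>2 \<le> (sinc s)\<^sup>2" by (intro power_mono) auto
  then show ?thesis
    using T unfolding fejer_def s_def[symmetric]
    by (intro mult_left_mono) (auto simp: power2_eq_square)
qed

text \<open>
  The kernel is the Fourier transform of a function supported in \<open>[-T, T]\<close>: this is what restricts
  the comparison of two laws to the values of their characteristic functions on \<open>[-T, T]\<close>. The
  identity is needed at \<open>y = 0\<close> as well, because it will be integrated against laws with atoms.
\<close>

lemma fejer_eq_triangle_transform:
  assumes T: "T > 0"
  shows "fejer T y = 1 / (2 * pi) * (LBINT t. triangle T t * cos (t * y))"
proof -
  \<comment> \<open>\<open>F\<close> and \<open>G\<close> are antiderivatives of the integrand on the two halves of the triangle.\<close>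
  define F where "F = (if y = 0 then (\<lambda>t. t - t\<^sup>2 / (2 * T))
    else (\<lambda>t. (1 - t / T) * (sin (t * y) / y) - cos (t * y) / (T * y\<^sup>2)))"
  define G where "G = (if y = 0 then (\<lambda>t. t + t\<^sup>2 / (2 * T))
    else (\<lambda>t. (1 + t / T) * (sin (t * y) / y) + cos (t * y) / (T * y\<^sup>2)))"
  have F: "(F has_real_derivative (1 - t / T) * cos (t * y)) (at t within S)" for t S
    unfolding F_def using T
    by (cases "y = 0") (auto intro!: derivative_eq_intros simp: field_simps power2_eq_square)
  have G: "(G has_real_derivative (1 + t / T) * cos (t * y)) (at t within S)" for t S
    unfolding G_def using T
    by (cases "y = 0") (auto intro!: derivative_eq_intros simp: field_simps power2_eq_square)
  have iF: "has_bochner_integral lborel (\<lambda>t. (1 - t / T) * cos (t * y) * indicator {0..T} t) (F T - F 0)"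
    using T F by (intro has_bochner_integral_FTC_Icc_real) (auto intro!: continuous_intros)
  have iG: "has_bochner_integral lborel (\<lambda>t. (1 + t / T) * cos (t * y) * indicator {-T..0} t) (G 0 - G (-T))"
    using T G by (intro has_bochner_integral_FTC_Icc_real) (auto intro!: continuous_intros)
  have "has_bochner_integral lborel (\<lambda>t. triangle T t * cos (t * y)) ((F T - F 0) + (G 0 - G (-T)))"
  proof (rule has_bochner_integralI_AE)
    show "has_bochner_integral lborel (\<lambda>t. (1 - t / T) * cos (t * y) * indicator {0..T} t
        + (1 + t / T) * cos (t * y) * indicator {-T..0} t)
      ((F T - F 0) + (G 0 - G (-T)))"
      by (intro has_bochner_integral_add iF iG)
    show "AE t in lborel. (1 - t / T) * cos (t * y) * indicator {0..T} t
        + (1 + t / T) * cos (t * y) * indicator {-T..0} t = triangle T t * cos (t * y)"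
      using AE_lborel_singleton[of 0]
      by eventually_elim (use T in \<open>auto simp: triangle_def indicator_def max_def field_simps\<close>)
  qed measurable
  then have "(LBINT t. triangle T t * cos (t * y)) = (F T - F 0) + (G 0 - G (-T))"
    by (rule has_bochner_integral_integral_eq)
  also have "\<dots> = 2 * pi * fejer T y"
  proof (cases "y = 0")
    case True
    then show ?thesis
      using T by (simp add: F_def G_def fejer_def field_simps power2_eq_square)
  next
    case y: False
    then have "(F T - F 0) + (G 0 - G (-T)) = 2 * (1 - cos (T * y)) / (T * y\<^sup>2)"
      using T by (simp add: F_def G_def field_simps)
    also have "cos (T * y) = 1 - 2 * (sin (T * y / 2))\<^sup>2"
      using cos_double_sin[of "T * y / 2"] by simp
    finally show ?thesis
      using T y by (simp add: fejer_def field_simps power2_eq_square)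
  qed
  finally show ?thesis
    by simp
qed

lemma nn_integral_inverse_square_atLeast:
  fixes h :: real assumes h: "h > 0"
  shows "(\<integral>\<^sup>+x. ennreal (1 / x\<^sup>2) * indicator {h..} x \<partial>lborel) = ennreal (1 / h)"
proof -
  have "(\<integral>\<^sup>+x. ennreal (1 / x\<^sup>2) * indicator {h..} x \<partial>lborel) = ennreal (0 - (- 1 / h))"
  proof (rule nn_integral_FTC_atLeast)
    show "((\<lambda>x. - 1 / x) has_real_derivative 1 / x\<^sup>2) (at x)" if "h \<le> x" for x
      using that h by (auto intro!: derivative_eq_intros simp: power2_eq_square)
    show "((\<lambda>x::real. - 1 / x) \<longlongrightarrow> 0) at_top"
      by real_asymp
  qed (auto)
  then show ?thesis by simp
qed

lemma nn_integral_fejer_tail: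
  assumes T: "T > 0" and h: "h > 0"
  shows "(\<integral>\<^sup>+y. ennreal (fejer T y) * indicator {y. h \<le> \<bar>y\<bar>} y \<partial>lborel)
    \<le> ennreal (4 / (pi * T * h))"
proof -
  let ?c = "2 / (pi * T)"
  have half: "(\<integral>\<^sup>+y. ennreal (1 / y\<^sup>2) * indicator {..-h} y \<partial>lborel) = ennreal (1 / h)"
    using nn_integral_inverse_square_atLeast[OF h]
    by (subst nn_integral_real_affine[where c = "-1" and t = 0])
       (auto simp: indicator_def cong: nn_integral_cong_simp)
  have "(\<integral>\<^sup>+y. ennreal (fejer T y) * indicator {y. h \<le> \<bar>y\<bar>} y \<partial>lborel)
    \<le> (\<integral>\<^sup>+y. ennreal ?c * (ennreal (1 / y\<^sup>2) * indicator {h..} y)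
           + ennreal ?c * (ennreal (1 / y\<^sup>2) * indicator {..-h} y) \<partial>lborel)"
  proof (intro nn_integral_mono)
    fix y :: real
    show "ennreal (fejer T y) * indicator {y. h \<le> \<bar>y\<bar>} y
      \<le> ennreal ?c * (ennreal (1 / y\<^sup>2) * indicator {h..} y)
           + ennreal ?c * (ennreal (1 / y\<^sup>2) * indicator {..-h} y)"
    proof (cases "h \<le> \<bar>y\<bar>")
      case True
      then have "fejer T y \<le> ?c * (1 / y\<^sup>2)"
        using fejer_le_tail[OF T] h by auto
      then have "ennreal (fejer T y) \<le> ennreal ?c * ennreal (1 / y\<^sup>2)"
        using T by (simp add: ennreal_leI flip: ennreal_mult)
      then show ?thesis
        using True h by (auto simp: indicator_def)
    qed (simp add: indicator_def)
  qed
  also have "\<dots> = ennreal ?c * ennreal (1 / h) + ennreal ?c * ennreal (1 / h)"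
    by (subst nn_integral_add)
       (auto simp: nn_integral_cmult half nn_integral_inverse_square_atLeast[OF h])
  also have "\<dots> = ennreal (?c * (1 / h) + ?c * (1 / h))"
    using T h by (simp flip: ennreal_mult ennreal_plus)
  also have "?c * (1 / h) + ?c * (1 / h) = 4 / (pi * T * h)"
    by simp
  finally show ?thesis .
qed

definition fejer_measure :: "real \<Rightarrow> real measure" where
  "fejer_measure T = density lborel (\<lambda>y. ennreal (fejer T y))"

lemma sets_fejer_measure[simp, measurable_cong]: "sets (fejer_measure T) = sets borel"
  by (simp add: fejer_measure_def)

lemma space_fejer_measure[simp]: "space (fejer_measure T) = UNIV"
  by (simp add: fejer_measure_def)

lemma emeasure_fejer_tail:
  assumes T: "T > 0" and h: "h > 0"
  shows "emeasure (fejer_measure T) {y. h \<le> \<bar>y\<bar>} \<le> ennreal (4 / (pi * T * h))"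
  using nn_integral_fejer_tail[OF assms]
  by (simp add: fejer_measure_def emeasure_density)

lemma finite_fejer_measure:
  assumes T: "T > 0"
  shows "finite_measure (fejer_measure T)"
proof
  have "emeasure (fejer_measure T) {-1..1}
      \<le> (\<integral>\<^sup>+y. ennreal (T / (2 * pi)) * indicator {-1..1::real} y \<partial>lborel)"
    using fejer_le_centre[OF T]
    by (auto simp: fejer_measure_def emeasure_density ennreal_leI indicator_def intro!: nn_integral_mono)
  also have "\<dots> < \<infinity>"
    by (simp add: nn_integral_cmult_indicator ennreal_mult_less_top)
  finally have "emeasure (fejer_measure T) {-1..1} < \<infinity>" .
  moreover have "emeasure (fejer_measure T) {y. 1 \<le> \<bar>y\<bar>} < \<infinity>"
    using emeasure_fejer_tail[OF T, of 1] by (auto intro: le_less_trans)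
  ultimately have "emeasure (fejer_measure T) {-1..1} + emeasure (fejer_measure T) {y. 1 \<le> \<bar>y\<bar>} < \<infinity>"
    by (simp add: ennreal_add_less_top)
  moreover have "emeasure (fejer_measure T) UNIV
      \<le> emeasure (fejer_measure T) {-1..1} + emeasure (fejer_measure T) {y. 1 \<le> \<bar>y\<bar>}"
  proof -
    have "emeasure (fejer_measure T) ({-1..1} \<union> {y. 1 \<le> \<bar>y\<bar>})
      \<le> emeasure (fejer_measure T) {-1..1} + emeasure (fejer_measure T) {y. 1 \<le> \<bar>y\<bar>}"
      by (intro emeasure_subadditive) auto
    also have "{-1..1} \<union> {y::real. 1 \<le> \<bar>y\<bar>} = UNIV" by auto
    finally show ?thesis .
  qed
  ultimately show "emeasure (fejer_measure T) (space (fejer_measure T)) \<noteq> \<infinity>"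
    by (auto simp: top_unique)
qed

lemma fejer_measure_tail:
  assumes T: "T > 0" and h: "h > 0"
  shows "measure (fejer_measure T) {y. h \<le> \<bar>y\<bar>} \<le> 4 / (pi * T * h)"
  using emeasure_fejer_tail[OF assms] T h
  by (simp add: finite_measure.emeasure_eq_measure[OF finite_fejer_measure[OF T]])

text \<open>
  The central interval \<open>[- 2 / T, 2 / T]\<close> alone has mass at least \<open>25 / (18 pi)\<close>.
\<close>

lemma fejer_measure_UNIV_ge:
  assumes T: "T > 0"
  shows "2 / 5 \<le> measure (fejer_measure T) UNIV"
proof -
  let ?I = "{-(2/T)..2/T}"
  have "ennreal (T / (2 * pi) * (25 / 36) * (4 / T))
    = (\<integral>\<^sup>+y. ennreal (T / (2 * pi) * (25 / 36)) * indicator ?I y \<partial>lborel)"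
    using T by (subst nn_integral_cmult_indicator) (auto simp: ennreal_mult[symmetric])
  also have "\<dots> \<le> emeasure (fejer_measure T) ?I"
    using fejer_ge_centre[OF T]
    by (auto simp: fejer_measure_def emeasure_density ennreal_leI indicator_def abs_le_iff intro!: nn_integral_mono)
  also have "\<dots> \<le> emeasure (fejer_measure T) UNIV"
    by (intro emeasure_mono) auto
  finally have "T / (2 * pi) * (25 / 36) * (4 / T) \<le> measure (fejer_measure T) UNIV"
    by (simp add: finite_measure.emeasure_eq_measure[OF finite_fejer_measure[OF T]])
  moreover have "2 / 5 \<le> T / (2 * pi) * (25 / 36) * (4 / T)"
    using T pi_approx by (simp add: field_simps)
  ultimately show ?thesis by linarith
qed

section \<open>A smoothing inequality for the Kolmogorov distance\<close>

text \<open>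
  Averaging the mass of a shifted interval over the shift is the same as integrating, over the fixed
  interval, the density of the law convolved with the kernel.
\<close>

lemma (in real_distribution) nn_integral_fejer_smoothing:
  "(\<integral>\<^sup>+z. emeasure M {a + z<..b + z} \<partial>fejer_measure T)
     = (\<integral>\<^sup>+x. (\<integral>\<^sup>+y. ennreal (fejer T (y - x)) \<partial>M) * indicator {a<..b} x \<partial>lborel)"
proof -
  interpret P: pair_sigma_finite M lborel ..
  have em: "emeasure M {a + z<..b + z} = (\<integral>\<^sup>+y. indicator {a<..b} (y - z) \<partial>M)" for z
  proof -
    have "emeasure M {a + z<..b + z} = (\<integral>\<^sup>+y. indicator {a + z<..b + z} y \<partial>M)"
      by simp
    also have "\<dots> = (\<integral>\<^sup>+y. indicator {a<..b} (y - z) \<partial>M)"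
      by (intro nn_integral_cong) (auto simp: indicator_def)
    finally show ?thesis .
  qed
  have "(\<integral>\<^sup>+z. emeasure M {a + z<..b + z} \<partial>fejer_measure T)
      = (\<integral>\<^sup>+z. ennreal (fejer T z) * (\<integral>\<^sup>+y. indicator {a<..b} (y - z) \<partial>M) \<partial>lborel)"
    unfolding em fejer_measure_def
    by (subst nn_integral_density) auto
  also have "\<dots> = (\<integral>\<^sup>+z. (\<integral>\<^sup>+y. ennreal (fejer T z) * indicator {a<..b} (y - z) \<partial>M) \<partial>lborel)"
    by (simp add: nn_integral_cmult)
  also have "\<dots> = (\<integral>\<^sup>+y. (\<integral>\<^sup>+z. ennreal (fejer T z) * indicator {a<..b} (y - z) \<partial>lborel) \<partial>M)"
    by (rule P.Fubini') simp
  also have "\<dots> = (\<integral>\<^sup>+y. (\<integral>\<^sup>+x. ennreal (fejer T (y - x)) * indicator {a<..b} x \<partial>lborel) \<partial>M)"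
  proof (rule nn_integral_cong)
    fix y :: real
    show "(\<integral>\<^sup>+z. ennreal (fejer T z) * indicator {a<..b} (y - z) \<partial>lborel)
        = (\<integral>\<^sup>+x. ennreal (fejer T (y - x)) * indicator {a<..b} x \<partial>lborel)"
      by (subst nn_integral_real_affine[where c = "-1" and t = y]) auto
  qed
  also have "\<dots> = (\<integral>\<^sup>+x. (\<integral>\<^sup>+y. ennreal (fejer T (y - x)) * indicator {a<..b} x \<partial>M) \<partial>lborel)"
    by (rule P.Fubini'[symmetric]) simp
  also have "\<dots> = (\<integral>\<^sup>+x. (\<integral>\<^sup>+y. ennreal (fejer T (y - x)) \<partial>M) * indicator {a<..b} x \<partial>lborel)"
    by (simp add: nn_integral_multc)
  finally show ?thesis .
qed

lemma (in real_distribution) integrable_fejer_shift: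
  "T > 0 \<Longrightarrow> integrable M (\<lambda>y. fejer T (y - x))"
  using fejer_le_centre fejer_nonneg
  by (intro integrable_const_bound[where B = "T / (2 * pi)"]) auto

lemma (in real_distribution) borel_measurable_cdf[measurable]: "cdf M \<in> borel_measurable borel"
  by (intro borel_measurable_mono) (auto simp: mono_def cdf_nondecreasing)

lemma (in real_distribution) integrable_cdf_shift:
  assumes "T > 0"
  shows "integrable (fejer_measure T) (\<lambda>z. cdf M (c + z))"
proof -
  interpret V: finite_measure "fejer_measure T" by (rule finite_fejer_measure[OF assms])
  show ?thesis
    by (intro V.integrable_const_bound[where B = 1]) (auto simp: cdf_nonneg cdf_bounded_prob)
qed

lemma (in real_distribution) fejer_smoothing:
  assumes T: "T > 0" and ab: "a < b"
  shows "(\<integral>z. cdf M (b + z) - cdf M (a + z) \<partial>fejer_measure T)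
     = (LBINT x. (LINT y|M. fejer T (y - x)) * indicator {a<..b} x)"
    and "integrable lborel (\<lambda>x. (LINT y|M. fejer T (y - x)) * indicator {a<..b} x)"
proof -
  have nn: "0 \<le> (LINT y|M. fejer T (y - x))" for x
    using fejer_nonneg[OF T] by simp
  have le: "(LINT y|M. fejer T (y - x)) \<le> T / (2 * pi)" for x
    using fejer_le_centre[OF T] integrable_fejer_shift[OF T]
    by (intro integral_le_const) auto
  show int: "integrable lborel (\<lambda>x. (LINT y|M. fejer T (y - x)) * indicator {a<..b} x)"
    by (rule integrableI_bounded_set[where A = "{a<..b}" and B = "T / (2 * pi)"])
       (use ab in \<open>auto simp: nn le indicator_def\<close>)
  have "emeasure M {a + z<..b + z} = ennreal (cdf M (b + z) - cdf M (a + z))" for z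
    using ab by (simp add: cdf_diff_eq emeasure_eq_measure)
  moreover have "cdf M (a + z) \<le> cdf M (b + z)" for z
    using ab by (simp add: cdf_nondecreasing)
  ultimately have "(\<integral>\<^sup>+z. emeasure M {a + z<..b + z} \<partial>fejer_measure T)
      = ennreal (\<integral>z. cdf M (b + z) - cdf M (a + z) \<partial>fejer_measure T)"
    using integrable_cdf_shift[OF T]
    by (subst nn_integral_eq_integral[symmetric]) auto
  moreover have "(\<integral>\<^sup>+x. (\<integral>\<^sup>+y. ennreal (fejer T (y - x)) \<partial>M) * indicator {a<..b} x \<partial>lborel)
      = (\<integral>\<^sup>+x. ennreal ((LINT y|M. fejer T (y - x)) * indicator {a<..b} x) \<partial>lborel)"
    using fejer_nonneg[OF T]
    by (intro nn_integral_cong, subst nn_integral_eq_integral[OF integrable_fejer_shift[OF T]])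
       (auto simp: indicator_def)
  moreover have "\<dots> = ennreal (LBINT x. (LINT y|M. fejer T (y - x)) * indicator {a<..b} x)"
    using nn by (intro nn_integral_eq_integral int) auto
  ultimately have "ennreal (\<integral>z. cdf M (b + z) - cdf M (a + z) \<partial>fejer_measure T)
      = ennreal (LBINT x. (LINT y|M. fejer T (y - x)) * indicator {a<..b} x)"
    using nn_integral_fejer_smoothing[where a = a and b = b and T = T] by simp
  then show "(\<integral>z. cdf M (b + z) - cdf M (a + z) \<partial>fejer_measure T)
     = (LBINT x. (LINT y|M. fejer T (y - x)) * indicator {a<..b} x)"
    using nn ab
    by (subst (asm) ennreal_inj) (auto intro!: integral_nonneg_AE AE_I2 cdf_nondecreasing)
qed

text \<open>
  Fourier inversion for the density of the convolved law. With a compactly supported weight it is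
  just an exchange of two integrals.
\<close>

lemma (in real_distribution) integral_fejer_eq_char:
  assumes T: "T > 0"
  shows "(LINT y|M. fejer T (y - x))
    = 1 / (2 * pi) * (LBINT t. triangle T t * Re (iexp (- (t * x)) * char M t))"
    and "integrable lborel (\<lambda>t. triangle T t * Re (iexp (- (t * x)) * char M t))"
proof -
  interpret P: pair_sigma_finite lborel M ..
  have supp: "- T \<le> t" "t \<le> T" if "triangle T t \<noteq> 0" for t
    using triangle_eq_0[OF T, of t] that by linarith+
  have bnd: "\<bar>triangle T t * cos u\<bar> \<le> 1" for t u
    using triangle_nonneg[of T t] triangle_le_1[OF T, of t] abs_cos_le_one[of u]
    by (simp add: abs_mult mult_le_one)
  have int: "integrable (lborel \<Otimes>\<^sub>M M) (\<lambda>(t, y). triangle T t * cos (t * (y - x)))"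
  proof (rule integrableI_bounded_set[where A = "{-T..T} \<times> space M" and B = 1])
    show "emeasure (lborel \<Otimes>\<^sub>M M) ({-T..T} \<times> space M) < \<infinity>"
      using T by (subst emeasure_pair_measure_Times)
        (auto simp: ennreal_mult_less_top not_less top_unique)
  qed (auto simp: bnd supp intro!: AE_I2)
  have inner: "(LINT y|M. triangle T t * cos (t * (y - x))) = triangle T t * Re (iexp (- (t * x)) * char M t)" for t
  proof -
    have "(LINT y|M. cos (t * (y - x))) = (LINT y|M. Re (iexp (- (t * x)) * iexp (t * y)))"
      by (intro Bochner_Integration.integral_cong)
         (auto simp: exp_add[symmetric] Re_exp algebra_simps cos_diff)
    also have "\<dots> = Re (CLINT y|M. iexp (- (t * x)) * iexp (t * y))"
      by (intro integral_Re integrable_mult_right integrable_iexp) auto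
    also have "\<dots> = Re (iexp (- (t * x)) * char M t)"
      by (simp add: char_def)
    finally show ?thesis
      by simp
  qed
  have "(LINT y|M. fejer T (y - x)) = 1 / (2 * pi) * (LINT y|M. (LBINT t. triangle T t * cos (t * (y - x))))"
    by (simp add: fejer_eq_triangle_transform[OF T])
  also have "(LINT y|M. (LBINT t. triangle T t * cos (t * (y - x)))) = (LBINT t. (LINT y|M. triangle T t * cos (t * (y - x))))"
    by (rule P.Fubini_integral[OF int])
  finally show "(LINT y|M. fejer T (y - x))
    = 1 / (2 * pi) * (LBINT t. triangle T t * Re (iexp (- (t * x)) * char M t))"
    by (simp only: inner)
  show "integrable lborel (\<lambda>t. triangle T t * Re (iexp (- (t * x)) * char M t))"
    using P.integrable_fst'[OF int] by (simp only: inner prod.case)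
qed

text \<open>
  The bound does not depend on the length of the interval, which later allows its left endpoint
  to tend to \<open>-\<infinity>\<close>. The factor \<open>1 / \<bar>t\<bar>\<close> is the one in Berry--Esseen type inequalities.
\<close>

lemma iexp_integral_bound:
  fixes a b t :: real and w :: complex
  assumes t: "t \<noteq> 0" and ab: "a \<le> b"
  shows "\<bar>LBINT x. Re (iexp (- (t * x)) * w) * indicator {a<..b} x\<bar> \<le> 2 * cmod w / \<bar>t\<bar>"
proof -
  define F where "F = (\<lambda>x. Re (\<i> / t * iexp (- (t * x)) * w))"
  have F: "\<bar>F x\<bar> \<le> cmod w / \<bar>t\<bar>" for x
    using abs_Re_le_cmod[of "\<i> / t * iexp (- (t * x)) * w"]
    by (simp add: F_def norm_mult norm_divide)
  have "has_bochner_integral lborel (\<lambda>x. Re (iexp (- (t * x)) * w) * indicator {a..b} x) (F b - F a)"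
  proof (rule has_bochner_integral_FTC_Icc_real[OF ab])
    show "(F has_real_derivative Re (iexp (- (t * x)) * w)) (at x)" for x
      using t unfolding F_def
      by (simp add: Re_exp Im_exp) (auto intro!: derivative_eq_intros simp: field_simps)
  qed (auto intro!: continuous_intros)
  then have "(LBINT x. Re (iexp (- (t * x)) * w) * indicator {a..b} x) = F b - F a"
    by (rule has_bochner_integral_integral_eq)
  moreover have "(LBINT x. Re (iexp (- (t * x)) * w) * indicator {a<..b} x)
      = (LBINT x. Re (iexp (- (t * x)) * w) * indicator {a..b} x)"
    by (intro integral_cong_AE eventually_mono[OF AE_lborel_singleton[of a]])
       (auto simp: indicator_def)
  ultimately show ?thesis
    using F[of a] F[of b] by simp
qed

text \<open>
  The difference of the two convolved densities is the inverse Fourier transform of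
  \<open>triangle T t * (char M t - char N t)\<close>. Integrating it first over \<open>{a<..b}\<close> costs
  \<open>2 / \<bar>t\<bar>\<close>, which is absorbed by the factor \<open>\<bar>t\<bar>\<close> in the hypothesis.
\<close>

lemma smoothed_cdf_increment_bound:
  assumes "real_distribution M" "real_distribution N"
    and T: "T > 0" and ab: "a < b"
    and q: "integrable lborel q" "\<And>t. 0 \<le> q t"
    and bound: "\<And>t. \<bar>t\<bar> \<le> T \<Longrightarrow> cmod (char M t - char N t) \<le> \<bar>t\<bar> * q t"
  shows "\<bar>(\<integral>z. cdf M (b + z) - cdf M (a + z) \<partial>fejer_measure T)
          - (\<integral>z. cdf N (b + z) - cdf N (a + z) \<partial>fejer_measure T)\<bar> \<le> (LBINT t. q t) / pi"
proof -
  interpret M: real_distribution M by fact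
  interpret N: real_distribution N by fact
  define w where "w = (\<lambda>t. char M t - char N t)"
  have [measurable]: "w \<in> borel_measurable borel"
    unfolding w_def by measurable
  \<comment> \<open>the integrand, as a function of frequency and position\<close>
  define f where "f = (\<lambda>t x. triangle T t * Re (iexp (- (t * x)) * w t) * indicator {a<..b} x)"
  have w2: "cmod (w t) \<le> 2" for t
    using norm_triangle_ineq4[of "char M t" "char N t"] M.cmod_char_le_1[of t] N.cmod_char_le_1[of t]
    by (simp add: w_def)
  have supp: "- T \<le> t" "t \<le> T" if "triangle T t \<noteq> 0" for t
    using triangle_eq_0[OF T, of t] that by linarith+
  have f_bound: "\<bar>f t x\<bar> \<le> 2" for t x
  proof -
    have "\<bar>Re (iexp (- (t * x)) * w t)\<bar> \<le> 2"
      using abs_Re_le_cmod[of "iexp (- (t * x)) * w t"] w2[of t] by (simp add: norm_mult)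
    then have "\<bar>triangle T t * Re (iexp (- (t * x)) * w t)\<bar> \<le> 1 * 2"
      using triangle_nonneg[of T t] triangle_le_1[OF T, of t] unfolding abs_mult by (intro mult_mono) auto
    then show ?thesis
      by (simp add: f_def indicator_def)
  qed
  have int: "integrable (lborel \<Otimes>\<^sub>M lborel) (\<lambda>(t, x). f t x)"
  proof (rule integrableI_bounded_set[where A = "{-T..T} \<times> {a<..b}" and B = 2])
    show "emeasure (lborel \<Otimes>\<^sub>M lborel) ({-T..T} \<times> {a<..b}) < \<infinity>"
      using T ab by (subst lborel.emeasure_pair_measure_Times) (auto simp: ennreal_mult_less_top)
    show "(\<lambda>(t, x). f t x) \<in> borel_measurable (lborel \<Otimes>\<^sub>M lborel)"
      unfolding f_def by measurable
    show "{-T..T} \<times> {a<..b} \<in> sets (lborel \<Otimes>\<^sub>M lborel)"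
      by measurable
    show "AE p in lborel \<Otimes>\<^sub>M lborel. p \<in> {-T..T} \<times> {a<..b} \<longrightarrow> norm (case p of (t, x) \<Rightarrow> f t x) \<le> 2"
      using f_bound by auto
    show "AE p in lborel \<Otimes>\<^sub>M lborel. p \<notin> {-T..T} \<times> {a<..b} \<longrightarrow> (case p of (t, x) \<Rightarrow> f t x) = 0"
      using supp by (auto simp: f_def indicator_def intro!: AE_I2)
  qed
  have "(\<integral>z. cdf M (b + z) - cdf M (a + z) \<partial>fejer_measure T)
          - (\<integral>z. cdf N (b + z) - cdf N (a + z) \<partial>fejer_measure T)
      = (LBINT x. (LINT y|M. fejer T (y - x)) * indicator {a<..b} x
                - (LINT y|N. fejer T (y - x)) * indicator {a<..b} x)"
    unfolding M.fejer_smoothing(1)[OF T ab] N.fejer_smoothing(1)[OF T ab]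
    by (rule Bochner_Integration.integral_diff[symmetric]; intro M.fejer_smoothing N.fejer_smoothing T ab)
  also have "\<dots> = (LBINT x. 1 / (2 * pi) * (LBINT t. f t x))"
  proof (rule Bochner_Integration.integral_cong[OF refl])
    fix x
    have "(LINT y|M. fejer T (y - x)) - (LINT y|N. fejer T (y - x))
        = 1 / (2 * pi) * ((LBINT t. triangle T t * Re (iexp (- (t * x)) * char M t))
           - (LBINT t. triangle T t * Re (iexp (- (t * x)) * char N t)))"
      unfolding M.integral_fejer_eq_char(1)[OF T] N.integral_fejer_eq_char(1)[OF T]
      by (simp only: right_diff_distrib)
    also have "(LBINT t. triangle T t * Re (iexp (- (t * x)) * char M t))
           - (LBINT t. triangle T t * Re (iexp (- (t * x)) * char N t))
        = (LBINT t. triangle T t * Re (iexp (- (t * x)) * char M t) - triangle T t * Re (iexp (- (t * x)) * char N t))"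
      by (intro Bochner_Integration.integral_diff[symmetric] M.integral_fejer_eq_char N.integral_fejer_eq_char T)
    also have "\<dots> = (LBINT t. triangle T t * Re (iexp (- (t * x)) * w t))"
      by (simp only: w_def right_diff_distrib minus_complex.simps)
    finally show "(LINT y|M. fejer T (y - x)) * indicator {a<..b} x
        - (LINT y|N. fejer T (y - x)) * indicator {a<..b} x = 1 / (2 * pi) * (LBINT t. f t x)"
      by (simp add: f_def indicator_def)
  qed
  also have "\<dots> = 1 / (2 * pi) * (LBINT x. (LBINT t. f t x))"
    by simp
  also have "(LBINT x. (LBINT t. f t x)) = (LBINT t. (LBINT x. f t x))"
    by (rule lborel_pair.Fubini_integral[OF int])
  finally have eq: "(\<integral>z. cdf M (b + z) - cdf M (a + z) \<partial>fejer_measure T)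
          - (\<integral>z. cdf N (b + z) - cdf N (a + z) \<partial>fejer_measure T)
      = 1 / (2 * pi) * (LBINT t. (LBINT x. f t x))" .
  have inner: "\<bar>LBINT x. f t x\<bar> \<le> 2 * q t" for t
  proof (cases "t = 0 \<or> triangle T t = 0")
    case True
    then show ?thesis
      using q(2)[of t] by (auto simp: f_def w_def M.char_zero N.char_zero)
  next
    case False
    then have t: "t \<noteq> 0" "\<bar>t\<bar> \<le> T"
      using supp[of t] by auto
    have "\<bar>LBINT x. f t x\<bar> = triangle T t * \<bar>LBINT x. Re (iexp (- (t * x)) * w t) * indicator {a<..b} x\<bar>"
      using triangle_nonneg[of T t] by (simp add: f_def abs_mult mult.assoc)
    also have "\<dots> \<le> 1 * (2 * cmod (w t) / \<bar>t\<bar>)"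
      using triangle_nonneg triangle_le_1[OF T] t ab by (intro mult_mono iexp_integral_bound) auto
    also have "\<dots> \<le> 2 * q t"
      using bound[OF t(2)] t(1) by (simp add: w_def field_simps)
    finally show ?thesis .
  qed
  have "\<bar>LBINT t. (LBINT x. f t x)\<bar> \<le> (LBINT t. 2 * q t)"
  proof (rule order_trans[OF integral_abs_bound], rule integral_mono)
    show "integrable lborel (\<lambda>t. \<bar>LBINT x. f t x\<bar>)"
      using lborel_pair.integrable_fst'[OF int] by (intro integrable_abs) (simp only: prod.case)
  qed (use q inner in auto)
  then show ?thesis
    unfolding eq by (simp add: abs_mult field_simps)
qed

lemma smoothed_cdf_bound:
  assumes "real_distribution M" "real_distribution N"
    and T: "T > 0"
    and q: "integrable lborel q" "\<And>t. 0 \<le> q t"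
    and bound: "\<And>t. \<bar>t\<bar> \<le> T \<Longrightarrow> cmod (char M t - char N t) \<le> \<bar>t\<bar> * q t"
  shows "\<bar>\<integral>z. cdf M (b + z) - cdf N (b + z) \<partial>fejer_measure T\<bar> \<le> (LBINT t. q t) / pi"
proof -
  interpret M: real_distribution M by fact
  interpret N: real_distribution N by fact
  interpret V: finite_measure "fejer_measure T" by (rule finite_fejer_measure[OF T])
  let ?S = "\<lambda>M c. \<integral>z. cdf M (c + z) \<partial>fejer_measure T"
  have lim: "(\<lambda>n. ?S L (- real n)) \<longlonglongrightarrow> 0" if "real_distribution L" for L
  proof -
    interpret L: real_distribution L by fact
    have "(\<lambda>n. ?S L (- real n)) \<longlonglongrightarrow> (\<integral>z. 0 \<partial>fejer_measure T)"
    proof (rule integral_dominated_convergence[where w = "\<lambda>_. 1"])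
      show "AE z in fejer_measure T. (\<lambda>n. cdf L (- real n + z)) \<longlonglongrightarrow> 0"
      proof (rule AE_I2)
        fix z
        have "filterlim (\<lambda>n. - real n + z) at_bot sequentially"
          by real_asymp
        then show "(\<lambda>n. cdf L (- real n + z)) \<longlonglongrightarrow> 0"
          by (rule filterlim_compose[OF L.cdf_lim_at_bot])
      qed
    qed (auto simp: L.cdf_nonneg L.cdf_bounded_prob)
    then show ?thesis by simp
  qed
  have "(\<lambda>n. \<bar>(?S M b - ?S M (- real n)) - (?S N b - ?S N (- real n))\<bar>) \<longlonglongrightarrow> \<bar>(?S M b - 0) - (?S N b - 0)\<bar>"
    by (intro tendsto_intros lim assms)
  moreover have "\<forall>\<^sub>F n in sequentially.
      \<bar>(?S M b - ?S M (- real n)) - (?S N b - ?S N (- real n))\<bar> \<le> (LBINT t. q t) / pi"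
  proof -
    have "\<forall>\<^sub>F n in sequentially. - real n < b"
      by real_asymp
    then show ?thesis
    proof eventually_elim
      case (elim n)
      have "?S L b - ?S L (- real n) = (\<integral>z. cdf L (b + z) - cdf L (- real n + z) \<partial>fejer_measure T)"
        if "real_distribution L" for L
        using real_distribution.integrable_cdf_shift[OF that T]
        by (intro Bochner_Integration.integral_diff[symmetric])
      then show ?case
        using smoothed_cdf_increment_bound[OF assms(1,2) T elim q bound] assms(1,2) by simp
    qed
  qed
  ultimately have "\<bar>(?S M b - 0) - (?S N b - 0)\<bar> \<le> (LBINT t. q t) / pi"
    by (rule tendsto_upperbound) simp
  then show ?thesis
    by (simp add: M.integrable_cdf_shift[OF T] N.integrable_cdf_shift[OF T])
qed

text \<open>
  The convolution sees a plateau of height \<open>d\<close> and half-width \<open>h\<close>. The constants: for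
  \<open>h \<ge> 40 / (pi * T)\<close> the kernel has mass at most \<open>1 / 10\<close> outside \<open>[-h, h]\<close>, hence at least
  \<open>2 / 5 - 1 / 10 = 3 / 10\<close> inside, and \<open>3 / 10 * d - 1 / 10 * \<eta> \<le> \<epsilon>\<close>.
\<close>

lemma plateau_le_smoothed:
  fixes D :: "real \<Rightarrow> real"
  assumes T: "T > 0" and h: "pi * T * h \<ge> 40" 
    and meas[measurable]: "D \<in> borel_measurable borel"
    and D: "\<And>x. \<bar>D x\<bar> \<le> \<eta>"
    and plateau: "\<And>z. \<bar>z\<bar> < h \<Longrightarrow> d \<le> D (c + z)"
    and smoothed: "(\<integral>z. D (c + z) \<partial>fejer_measure T) \<le> \<epsilon>" and \<epsilon>: "0 \<le> \<epsilon>"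
  shows "d \<le> 10 / 3 * \<epsilon> + \<eta> / 3"
proof (cases "d \<le> 0")
  case True
  then show ?thesis
    using \<epsilon> D[of 0] by simp
next
  case False
  interpret V: finite_measure "fejer_measure T" by (rule finite_fejer_measure[OF T])
  let ?V = "measure (fejer_measure T)" and ?A = "{z. h \<le> \<bar>z\<bar>}" and ?B = "{z. \<bar>z\<bar> < h}"
  have h0: "h > 0"
  proof (rule ccontr)
    assume "\<not> h > 0"
    then have "pi * T * h \<le> 0"
      using T by (simp add: mult_le_0_iff)
    then show False using h by simp
  qed
  have "?V ?A \<le> 4 / (pi * T * h)"
    by (rule fejer_measure_tail[OF T h0])
  also have "\<dots> \<le> 4 / 40"
    using h by (intro divide_left_mono) auto
  finally have A: "?V ?A \<le> 1 / 10" by simp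
  have [simp]: "{z::real. \<bar>z\<bar> < h} \<in> sets borel" "{z::real. h \<le> \<bar>z\<bar>} \<in> sets borel"
    by measurable
  have [simp]: "integrable (fejer_measure T) (indicator ?A :: real \<Rightarrow> real)"
      "integrable (fejer_measure T) (indicator ?B :: real \<Rightarrow> real)"
    by (auto intro!: integrable_real_indicator simp: less_top[symmetric])
  have "?V UNIV = ?V ?A + ?V ?B"
    by (subst V.finite_measure_Union[symmetric]) (auto intro!: arg_cong[where f = ?V])
  then have B: "3 / 10 \<le> ?V ?B"
    using A fejer_measure_UNIV_ge[OF T] by linarith
  have "d * (3 / 10) - \<eta> * (1 / 10) \<le> d * ?V ?B - \<eta> * ?V ?A"
    using False A B D[of 0] by (intro diff_mono mult_left_mono) auto
  also have "\<dots> = (\<integral>z. d * indicator ?B z - \<eta> * indicator ?A z \<partial>fejer_measure T)"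
    by (subst Bochner_Integration.integral_diff) auto
  also have "\<dots> \<le> (\<integral>z. D (c + z) \<partial>fejer_measure T)"
  proof (rule integral_mono)
    show "integrable (fejer_measure T) (\<lambda>z. D (c + z))"
      using D by (intro V.integrable_const_bound[where B = \<eta>]) auto
    show "d * indicator ?B z - \<eta> * indicator ?A z \<le> D (c + z)" for z
      using plateau[of z] D[of "c + z"] by (auto simp: indicator_def abs_le_iff)
  qed auto
  finally show ?thesis
    using smoothed by simp
qed

text \<open>
  If \<open>cdf M - cdf N\<close> is large and positive at \<open>x\<close>, then it loses at most \<open>2 * m * h\<close> on the interval from
  \<open>x\<close> to \<open>x + 2 * h\<close>, since \<open>cdf M\<close> increases and \<open>cdf N\<close> is Lipschitz; if it is negative, the same
  holds to the left of \<open>x\<close>. So there is a plateau around \<open>x + h\<close> or \<open>x - h\<close>, and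
  \<open>plateau_le_smoothed\<close> bounds the supremum \<open>\<eta>\<close> of the difference by a third of itself plus
  controlled terms.
\<close>

theorem kolmogorov_smoothing_inequality:
  assumes M: "real_distribution M" and N: "real_distribution N"
    and T: "T > 0"
    and q: "integrable lborel q" "\<And>t. 0 \<le> q t"
    and bound: "\<And>t. \<bar>t\<bar> \<le> T \<Longrightarrow> cmod (char M t - char N t) \<le> \<bar>t\<bar> * q t"
    and lip: "\<And>x y. x \<le> y \<Longrightarrow> cdf N y - cdf N x \<le> m * (y - x)"
  shows "(SUP x. \<bar>cdf M x - cdf N x\<bar>) \<le> 5 * (LBINT t. q t) / pi + 120 * m / (pi * T)"
proof -
  interpret M: real_distribution M by fact
  interpret N: real_distribution N by fact
  define h where "h = 40 / (pi * T)"
  define \<eta> where "\<eta> = (SUP x. \<bar>cdf M x - cdf N x\<bar>)"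
  define \<epsilon> where "\<epsilon> = (LBINT t. q t) / pi"
  have h: "h > 0" "pi * T * h \<ge> 40"
    using T by (simp_all add: h_def)
  have \<epsilon>: "0 \<le> \<epsilon>"
    using q(2) by (simp add: \<epsilon>_def)
  have "\<bar>cdf M x - cdf N x\<bar> \<le> 1" for x
    using M.cdf_nonneg[of x] N.cdf_nonneg[of x] M.cdf_bounded_prob[of x] N.cdf_bounded_prob[of x]
    by linarith
  then have "bdd_above (range (\<lambda>x. \<bar>cdf M x - cdf N x\<bar>))"
    by (intro bdd_aboveI[of _ 1]) auto
  then have \<eta>: "\<bar>cdf M x - cdf N x\<bar> \<le> \<eta>" for x
    unfolding \<eta>_def by (rule cSUP_upper[OF UNIV_I])
  have "\<bar>cdf M x - cdf N x\<bar> \<le> 10 / 3 * \<epsilon> + \<eta> / 3 + 2 * m * h" for x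
  proof -
    have "cdf M x - cdf N x - 2 * m * h \<le> 10 / 3 * \<epsilon> + \<eta> / 3"
    proof (rule plateau_le_smoothed[OF T h(2) _ \<eta>])
      fix z :: real assume z: "\<bar>z\<bar> < h"
      have "cdf M x \<le> cdf M (x + h + z)" "cdf N (x + h + z) \<le> cdf N (x + 2 * h)"
        using z by (intro M.cdf_nondecreasing N.cdf_nondecreasing; linarith)+
      then show "cdf M x - cdf N x - 2 * m * h \<le> cdf M (x + h + z) - cdf N (x + h + z)"
        using lip[of x "x + 2 * h"] h by simp
    next
      show "(\<integral>z. cdf M (x + h + z) - cdf N (x + h + z) \<partial>fejer_measure T) \<le> \<epsilon>"
        using smoothed_cdf_bound[OF M N T q bound, of "x + h"] by (simp add: \<epsilon>_def)
    qed (use \<epsilon> in auto)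
    moreover have "cdf N x - cdf M x - 2 * m * h \<le> 10 / 3 * \<epsilon> + \<eta> / 3"
    proof (rule plateau_le_smoothed[OF T h(2), where D = "\<lambda>x. cdf N x - cdf M x" and c = "x - h"])
      fix z :: real assume z: "\<bar>z\<bar> < h"
      have "cdf M (x - h + z) \<le> cdf M x" "cdf N (x - 2 * h) \<le> cdf N (x - h + z)"
        using z by (intro M.cdf_nondecreasing N.cdf_nondecreasing; linarith)+
      then show "cdf N x - cdf M x - 2 * m * h \<le> cdf N (x - h + z) - cdf M (x - h + z)"
        using lip[of "x - 2 * h" x] h by simp
    next
      have "(\<integral>z. cdf N (x - h + z) - cdf M (x - h + z) \<partial>fejer_measure T)
          = - (\<integral>z. cdf M (x - h + z) - cdf N (x - h + z) \<partial>fejer_measure T)"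
        by (subst integral_minus[symmetric]) simp
      then show "(\<integral>z. cdf N (x - h + z) - cdf M (x - h + z) \<partial>fejer_measure T) \<le> \<epsilon>"
        using smoothed_cdf_bound[OF M N T q bound, of "x - h"] by (simp add: \<epsilon>_def)
    qed (use \<epsilon> \<eta> in \<open>auto simp: abs_minus_commute\<close>)
    ultimately show ?thesis
      by linarith
  qed
  then have "\<eta> \<le> 10 / 3 * \<epsilon> + \<eta> / 3 + 2 * m * h"
    unfolding \<eta>_def by (intro cSUP_least) auto
  then have "\<eta> \<le> 5 * \<epsilon> + 3 * m * h"
    by simp
  then show ?thesis
    by (simp add: \<eta>_def[symmetric] \<epsilon>_def h_def)
qed

section \<open>Gaussian Hermitian matrices and their determinants\<close>

lemma hermitian_entry:
  fixes A :: "complex mat"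
  assumes A: "A \<in> carrier_mat n n" and adj: "mat_adjoint A = A" and ij: "i < n" "j < n"
  shows "A $$ (i, j) = cnj (A $$ (j, i))"
proof -
  have "A $$ (i, j) = mat_adjoint A $$ (i, j)"
    using adj by simp
  also have "\<dots> = cnj (A $$ (j, i))"
    using A ij by (simp add: mat_adjoint_def mat_of_rows_index conjugate_complex_def)
  finally show ?thesis .
qed

lemma hermitian_entry_eq_coord:
  fixes A :: "complex mat"
  assumes A: "A \<in> carrier_mat n n" "mat_adjoint A = A" and ij: "i < n" "j < n"
  shows "A $$ (i, j) = (if i = j then of_real (hermitian_coord A (i, j))
    else if i < j then Complex (hermitian_coord A (i, j)) (hermitian_coord A (j, i))
    else Complex (hermitian_coord A (j, i)) (- hermitian_coord A (i, j)))"
  using hermitian_entry[OF A ij]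
  by (auto simp: hermitian_coord_def complex_eq_iff)

lemma gaussian_hermitian_entry_measurable:
  assumes G: "gaussian_hermitian M n s W" and ij: "i < n" "j < n"
  shows "(\<lambda>\<omega>. W \<omega> $$ (i, j)) \<in> borel_measurable M"
proof -
  have meas[measurable]: "(\<lambda>\<omega>. hermitian_coord (W \<omega>) (k, l)) \<in> borel_measurable M" if "k < n" "l < n" for k l
    using G that distributed_measurable[of M lborel "\<lambda>\<omega>. hermitian_coord (W \<omega>) (k, l)"]
    unfolding gaussian_hermitian_def by (metis measurable_lborel1)
  have "(\<lambda>\<omega>. if i = j then of_real (hermitian_coord (W \<omega>) (i, j))
    else if i < j then Complex (hermitian_coord (W \<omega>) (i, j)) (hermitian_coord (W \<omega>) (j, i))
    else Complex (hermitian_coord (W \<omega>) (j, i)) (- hermitian_coord (W \<omega>) (i, j))) \<in> borel_measurable M"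
    using ij unfolding Complex_eq by measurable
  then show ?thesis
    using G ij unfolding gaussian_hermitian_def
    by (subst measurable_cong[OF hermitian_entry_eq_coord]) auto
qed

lemma gaussian_hermitian_X_H_measurable:
  assumes G: "gaussian_hermitian M n s W"
  shows "X_H n W \<in> borel_measurable M"
proof -
  have [measurable]: "(\<lambda>\<omega>. W \<omega> $$ (i, j)) \<in> borel_measurable M" if "i < n" "j < n" for i j
    using gaussian_hermitian_entry_measurable[OF G that] .
  have "(\<lambda>\<omega>. \<Sum>p\<in>{p. p permutes {0..<n}}. signof p * (\<Prod>i = 0..<n. W \<omega> $$ (i, p i))) \<in> borel_measurable M"
    by (intro borel_measurable_sum borel_measurable_times borel_measurable_prod borel_measurable_const
         gaussian_hermitian_entry_measurable[OF G]) (auto dest: permutes_in_image)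
  then have [measurable]: "(\<lambda>\<omega>. Determinant.det (W \<omega>)) \<in> borel_measurable M"
    using G unfolding gaussian_hermitian_def
    by (subst measurable_cong[OF det_def']) auto
  show ?thesis
    unfolding X_H_def by measurable
qed

text \<open>
  A matrix of size one has its entry as only eigenvalue, which turns the joint density of the
  eigenvalues into the density of this entry.
\<close>

lemma is_eigenvalue_tuple_1:
  assumes "A \<in> carrier_mat 1 1"
  shows "is_eigenvalue_tuple 1 A x \<longleftrightarrow> A $$ (0, 0) = of_real (x 0)"
proof -
  have "char_poly A = char_poly_matrix A $$ (0, 0)"
    unfolding char_poly_def using assms by (intro det_single) (rule char_poly_matrix_closed)
  also have "\<dots> = [:- (A $$ (0, 0)), 1:]"
    using assms by (simp add: char_poly_matrix_def)
  finally show ?thesis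
    by (simp add: is_eigenvalue_tuple_def)
qed

text \<open>
  For size one every event is permutation invariant and the Vandermonde factor is an empty product.
  So the law of the entry has a density proportional to \<open>exp (- x\<^sup>2 / 2)\<close>, and total mass \<open>1\<close> fixes
  the factor.
\<close>

lemma GUE_1_distributed:
  assumes "GUE_matrix M 1 W"
  shows "distributed M lborel (\<lambda>\<omega>. Re (W \<omega> $$ (0, 0))) std_normal_density"
proof -
  note One_nat_def[simp del]
  from assms obtain s where prob: "prob_space M" and G: "gaussian_hermitian M 1 s W"
    and eig: "eigenvalue_density_proportional M 1 W
       (\<lambda>x. (\<Prod>k<1. \<Prod>j<k. \<bar>x k - x j\<bar> ^ 2) * (\<Prod>k<1. exp (- (x k)\<^sup>2 / 2)))"
    unfolding GUE_matrix_def by blast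
  interpret prob_space M by (rule prob)
  let ?N = "\<lambda>\<omega>. Re (W \<omega> $$ (0, 0))"
  have W: "W \<omega> \<in> carrier_mat 1 1" "W \<omega> $$ (0, 0) = of_real (?N \<omega>)" if "\<omega> \<in> space M" for \<omega>
    using G that hermitian_entry[of "W \<omega>" 1 0 0]
    by (auto simp: gaussian_hermitian_def complex_eq_iff)
  have N[measurable]: "?N \<in> borel_measurable M"
    using gaussian_hermitian_entry_measurable[OF G, of 0 0] by simp
  have one: "{..<1} = {0::nat}" by auto
  have dens: "(\<Prod>k<1. \<Prod>j<k. \<bar>x k - x j\<bar> ^ 2) * (\<Prod>k<1. exp (- (x k)\<^sup>2 / 2)) = exp (- (x 0)\<^sup>2 / 2)"
    for x :: "nat \<Rightarrow> real"
    by (simp add: one)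
  obtain c where c: "c > 0" and eig: "\<And>B. B \<in> sets (Pi\<^sub>M {..<1} (\<lambda>_. lborel)) \<Longrightarrow> perm_invariant 1 B \<Longrightarrow>
        emeasure M {\<omega>\<in>space M. \<exists>x\<in>B. is_eigenvalue_tuple 1 (W \<omega>) x} =
          emeasure (density (Pi\<^sub>M {..<1} (\<lambda>_. lborel)) (\<lambda>x. ennreal (c * exp (- (x 0)\<^sup>2 / 2)))) B"
    using eig unfolding eigenvalue_density_proportional_def dens by blast
  define f where "f = (\<lambda>x::real. ennreal (c * exp (- x\<^sup>2 / 2)))"
  have [measurable]: "f \<in> borel_measurable borel"
    unfolding f_def by measurable
  interpret P: product_sigma_finite "\<lambda>_::nat. lborel :: real measure" ..
  have law: "distr M lborel ?N = density lborel f"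
  proof (rule measure_eqI)
    fix A :: "real set" assume "A \<in> sets (distr M lborel ?N)"
    then have A[measurable]: "A \<in> sets borel" by simp
    define B where "B = {x \<in> space (Pi\<^sub>M {..<1} (\<lambda>_::nat. lborel :: real measure)). x 0 \<in> A}"
    have x0[measurable]: "(\<lambda>x. x 0) \<in> Pi\<^sub>M {..<1} (\<lambda>_::nat. lborel :: real measure) \<rightarrow>\<^sub>M lborel"
      by (rule measurable_component_singleton) auto
    have B[measurable]: "B \<in> sets (Pi\<^sub>M {..<1} (\<lambda>_. lborel))"
      unfolding B_def by measurable
    have "perm_invariant 1 B"
      unfolding perm_invariant_def one permutes_sing by simp
    note eigB = eig[OF B this]
    have "(\<exists>x\<in>B. is_eigenvalue_tuple 1 (W \<omega>) x) \<longleftrightarrow> ?N \<omega> \<in> A" if "\<omega> \<in> space M" for \<omega>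
    proof
      assume "\<exists>x\<in>B. is_eigenvalue_tuple 1 (W \<omega>) x"
      then show "?N \<omega> \<in> A"
        using W[OF that] by (auto simp: is_eigenvalue_tuple_1 B_def)
    next
      assume "?N \<omega> \<in> A"
      then have "(\<lambda>i\<in>{..<1}. ?N \<omega>) \<in> B" "is_eigenvalue_tuple 1 (W \<omega>) (\<lambda>i\<in>{..<1}. ?N \<omega>)"
        using W[OF that] by (auto simp: is_eigenvalue_tuple_1 B_def space_PiM)
      then show "\<exists>x\<in>B. is_eigenvalue_tuple 1 (W \<omega>) x" by blast
    qed
    then have "{\<omega>\<in>space M. \<exists>x\<in>B. is_eigenvalue_tuple 1 (W \<omega>) x} = ?N -` A \<inter> space M"
      by auto
    then have "emeasure (distr M lborel ?N) A
        = emeasure (density (Pi\<^sub>M {..<1} (\<lambda>_. lborel)) (\<lambda>x. f (x 0))) B"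
      using eigB by (simp add: emeasure_distr f_def)
    also have "\<dots> = (\<integral>\<^sup>+x. f (x 0) * indicator B x \<partial>Pi\<^sub>M {..<1} (\<lambda>_. lborel))"
      by (subst emeasure_density) auto
    also have "\<dots> = (\<integral>\<^sup>+x. f (x 0) * indicator A (x 0) \<partial>Pi\<^sub>M {0::nat} (\<lambda>_. lborel))"
      unfolding one by (intro nn_integral_cong) (auto simp: B_def one indicator_def)
    also have "\<dots> = (\<integral>\<^sup>+x. f x * indicator A x \<partial>lborel)"
      by (rule P.product_nn_integral_singleton[where f = "\<lambda>x. f x * indicator A x"]) measurable
    also have "\<dots> = emeasure (density lborel f) A"
      by (subst emeasure_density) auto
    finally show "emeasure (distr M lborel ?N) A = emeasure (density lborel f) A" .
  qed simp
  have f: "f = (\<lambda>x. ennreal (c * sqrt (2 * pi)) * ennreal (std_normal_density x))"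
    using c by (auto simp: f_def std_normal_density_def ennreal_mult[symmetric])
  have "1 = emeasure (distr M lborel ?N) UNIV"
    using prob_space.emeasure_space_1[OF prob_space_distr[of ?N lborel]] by simp
  also have "\<dots> = (\<integral>\<^sup>+x. f x \<partial>lborel)"
    by (simp add: law emeasure_density)
  also have "\<dots> = ennreal (c * sqrt (2 * pi)) * (\<integral>\<^sup>+x. ennreal (std_normal_density x) \<partial>lborel)"
    unfolding f by (rule nn_integral_cmult) simp
  also have "(\<integral>\<^sup>+x. ennreal (std_normal_density x) \<partial>lborel) = 1"
    using prob_space.emeasure_space_1[OF prob_space_normal_density[of 1 0]] by (simp add: emeasure_density)
  finally have "ennreal (c * sqrt (2 * pi)) = 1"
    by simp
  then have "f = (\<lambda>x. ennreal (std_normal_density x))"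
    by (simp add: f)
  then show ?thesis
    using law by (simp add: distributed_def)
qed

section \<open>Matrices of size one\<close>

lemma has_bochner_integral_neg_ln_unit_interval:
  "has_bochner_integral lborel (\<lambda>x::real. - ln x * indicator {0<..<1} x) 1"
proof -
  define F where "F = (\<lambda>x::real. x - x * ln x)"
  have F: "(F has_real_derivative - ln x) (at x)" if "0 < x" for x
    using that unfolding F_def by (auto intro!: derivative_eq_intros)
  have lim0: "((F \<circ> real_of_ereal) \<longlongrightarrow> 0) (at_right 0)"
    unfolding zero_ereal_def ereal_tendsto_simps F_def by real_asymp
  have lim1: "((F \<circ> real_of_ereal) \<longlongrightarrow> 1) (at_left 1)"
    unfolding one_ereal_def ereal_tendsto_simps F_def by real_asymp
  have "set_integrable lborel (einterval 0 1) (\<lambda>x. - ln x)"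
    and "(LBINT x=0..1. - ln x) = 1 - 0"
    by (rule interval_integral_FTC_nonneg[OF _ _ _ _ lim0 lim1];
        auto intro!: F AE_I2 continuous_intros simp: zero_ereal_def one_ereal_def)+
  then show ?thesis
    by (auto simp: has_bochner_integral_iff set_integrable_def interval_lebesgue_integral_def
        set_lebesgue_integral_def zero_ereal_def one_ereal_def mult.commute)
qed

lemma has_bochner_integral_neg_ln_abs:
  "has_bochner_integral lborel (\<lambda>x::real. - ln \<bar>x\<bar> * indicator {-1<..<1} x) 2"
proof -
  note pos = has_bochner_integral_neg_ln_unit_interval
  have neg: "has_bochner_integral lborel (\<lambda>x::real. - ln (- x) * indicator {0<..<1} (- x)) 1"
    using lborel_has_bochner_integral_real_affine_iff[of "-1" "\<lambda>x. - ln x * indicator {0<..<1} x" 1 0] pos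
    by simp
  have "has_bochner_integral lborel
      (\<lambda>x::real. - ln x * indicator {0<..<1} x + - ln (- x) * indicator {0<..<1} (- x)) (1 + 1)"
    by (rule has_bochner_integral_add[OF pos neg])
  also have "(\<lambda>x::real. - ln x * indicator {0<..<1} x + - ln (- x) * indicator {0<..<1} (- x))
      = (\<lambda>x. - ln \<bar>x\<bar> * indicator {-1<..<1} x)"
    by (auto simp: fun_eq_iff indicator_def abs_if)
  finally show ?thesis by simp
qed

lemma std_normal_density_le: "std_normal_density x \<le> 2 / 5"
proof -
  have "(5 / 2)\<^sup>2 \<le> 2 * pi"
    using pi_approx by (simp add: power2_eq_square)
  then have "5 / 2 \<le> sqrt (2 * pi)"
    by (rule real_le_rsqrt)
  then have "1 / sqrt (2 * pi) \<le> 2 / 5"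
    by (simp add: field_simps)
  moreover have "exp (- x\<^sup>2 / 2) \<le> 1" by simp
  ultimately have "1 / sqrt (2 * pi) * exp (- x\<^sup>2 / 2) \<le> 2 / 5 * 1"
    by (intro mult_mono) auto
  then show ?thesis
    by (simp add: std_normal_density_def)
qed

lemma abs_mu_H_1: "\<bar>mu_H 1\<bar> \<le> 3 / 5"
proof -
  have "ln (2 * pi) \<le> ln (2 ^ 3)"
    using pi_approx by (subst ln_le_cancel_iff) auto
  also have "\<dots> = 3 * ln 2"
    by (subst ln_realpow) auto
  also have "\<dots> \<le> 3 * (25 / 36)"
    using ln2_le_25_over_36 by simp
  finally have "ln (2 * pi) \<le> 25 / 12" by simp
  moreover have "0 \<le> ln (2 * pi)"
    using pi_approx by (intro ln_ge_zero) auto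
  moreover have "mu_H 1 = ln (2 * pi) / 2 - 1 / 2"
    by (simp add: mu_H_def)
  ultimately show ?thesis
    unfolding abs_le_iff by linarith
qed

text \<open>
  Near \<open>0\<close> the density is at most \<open>2 / 5\<close> and \<open>- ln \<bar>x\<bar>\<close> has integral \<open>2\<close> over \<open>(-1, 1)\<close>; elsewhere
  \<open>ln \<bar>x\<bar> \<le> x\<^sup>2 / 2\<close> and the second moment is \<open>1\<close>. With \<open>\<bar>mu_H 1\<bar> \<le> 3 / 5\<close> this amounts to
  \<open>4 / 5 + 1 / 2 + 3 / 5 \<le> 2\<close>.
\<close>

lemma std_normal_abs_ln_moment:
  shows "integrable lborel (\<lambda>x. std_normal_density x * \<bar>ln \<bar>x\<bar> - mu_H 1\<bar>)"
    and "(LBINT x. std_normal_density x * \<bar>ln \<bar>x\<bar> - mu_H 1\<bar>) \<le> 2"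
proof -
  define g where "g = (\<lambda>x. 2 / 5 * (- ln \<bar>x\<bar> * indicator {-1<..<1} x)
    + 1 / 2 * (std_normal_density x * x ^ (2 * 1)) + 3 / 5 * (std_normal_density x * x ^ (2 * 0)))"
  have g: "has_bochner_integral lborel g (2 / 5 * 2
     + 1 / 2 * (fact (2 * 1) / (2 ^ 1 * fact 1)) + 3 / 5 * (fact (2 * 0) / (2 ^ 0 * fact 0)))"
    unfolding g_def
    by (intro has_bochner_integral_add has_bochner_integral_mult_right
        has_bochner_integral_neg_ln_abs std_normal_moment_even)
  have le: "std_normal_density x * \<bar>ln \<bar>x\<bar> - mu_H 1\<bar> \<le> g x" for x
  proof -
    have "std_normal_density x * \<bar>ln \<bar>x\<bar>\<bar>
      \<le> 2 / 5 * (- ln \<bar>x\<bar> * indicator {-1<..<1} x) + 1 / 2 * (std_normal_density x * x\<^sup>2)"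
    proof (cases "\<bar>x\<bar> < 1")
      case True
      then have ln: "ln \<bar>x\<bar> \<le> 0"
        by (cases "x = 0") auto
      have "std_normal_density x * - ln \<bar>x\<bar> \<le> 2 / 5 * - ln \<bar>x\<bar>"
        using ln std_normal_density_le by (intro mult_right_mono) auto
      moreover have "0 \<le> std_normal_density x * x\<^sup>2"
        by (intro mult_nonneg_nonneg) auto
      moreover have eq: "\<bar>ln \<bar>x\<bar>\<bar> = - ln \<bar>x\<bar>" "indicator {-1<..<1} x = (1 :: real)"
        using ln True by (auto simp: indicator_def)
      ultimately show ?thesis
        unfolding eq by linarith
    next
      case False
      have "ln \<bar>x\<bar> \<le> \<bar>x\<bar> - 1"
        using False by (intro ln_le_minus_one) auto
      also have "\<dots> \<le> x\<^sup>2 / 2"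
        using zero_le_power2[of "\<bar>x\<bar> - 1"] by (simp add: power2_diff)
      finally have "\<bar>ln \<bar>x\<bar>\<bar> \<le> 1 / 2 * x\<^sup>2"
        using False by simp
      then have "std_normal_density x * \<bar>ln \<bar>x\<bar>\<bar> \<le> std_normal_density x * (1 / 2 * x\<^sup>2)"
        by (intro mult_left_mono) auto
      then show ?thesis
        using False by (auto simp: indicator_def)
    qed
    moreover have "\<bar>ln \<bar>x\<bar> - mu_H 1\<bar> \<le> \<bar>ln \<bar>x\<bar>\<bar> + 3 / 5"
      using abs_mu_H_1 by linarith
    then have "std_normal_density x * \<bar>ln \<bar>x\<bar> - mu_H 1\<bar>
        \<le> std_normal_density x * (\<bar>ln \<bar>x\<bar>\<bar> + 3 / 5)"
      by (intro mult_left_mono) auto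
    moreover have "std_normal_density x * (\<bar>ln \<bar>x\<bar>\<bar> + 3 / 5)
        = std_normal_density x * \<bar>ln \<bar>x\<bar>\<bar> + 3 / 5 * std_normal_density x"
      by (simp add: distrib_left)
    moreover have "g x = 2 / 5 * (- ln \<bar>x\<bar> * indicator {-1<..<1} x)
        + 1 / 2 * (std_normal_density x * x\<^sup>2) + 3 / 5 * std_normal_density x"
      by (simp add: g_def)
    ultimately show ?thesis
      by linarith
  qed
  show int: "integrable lborel (\<lambda>x. std_normal_density x * \<bar>ln \<bar>x\<bar> - mu_H 1\<bar>)"
  proof (rule Bochner_Integration.integrable_bound[OF integrable.intros[OF g]])
    show "AE x in lborel. norm (std_normal_density x * \<bar>ln \<bar>x\<bar> - mu_H 1\<bar>) \<le> norm (g x)"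
      using le by (intro AE_I2) (simp add: abs_mult order_trans[OF _ abs_ge_self])
  qed measurable
  have "(LBINT x. std_normal_density x * \<bar>ln \<bar>x\<bar> - mu_H 1\<bar>) \<le> integral\<^sup>L lborel g"
    using int integrable.intros[OF g] le by (rule integral_mono)
  also have "\<dots> \<le> 2"
    by (subst has_bochner_integral_integral_eq[OF g]) simp
  finally show "(LBINT x. std_normal_density x * \<bar>ln \<bar>x\<bar> - mu_H 1\<bar>) \<le> 2" .
qed

lemma GUE_1_X_H_moment:
  assumes G: "GUE_matrix M 1 W"
  shows "integrable M (X_H 1 W)" and "(LINT \<omega>|M. \<bar>X_H 1 W \<omega>\<bar>) \<le> 2"
proof -
  note One_nat_def[simp del]
  note D = GUE_1_distributed[OF G]
  have X: "X_H 1 W \<omega> = ln \<bar>Re (W \<omega> $$ (0, 0))\<bar> - mu_H 1" if "\<omega> \<in> space M" for \<omega>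
  proof -
    have W: "W \<omega> \<in> carrier_mat 1 1" "mat_adjoint (W \<omega>) = W \<omega>"
      using G that by (auto simp: GUE_matrix_def gaussian_hermitian_def)
    then have "Im (W \<omega> $$ (0, 0)) = 0"
      using hermitian_entry[OF W, of 0 0] by (auto simp: complex_eq_iff)
    then show ?thesis
      using det_single[OF W(1)] by (simp add: X_H_def cmod_eq_Re)
  qed
  have int: "integrable M (\<lambda>\<omega>. \<bar>ln \<bar>Re (W \<omega> $$ (0, 0))\<bar> - mu_H 1\<bar>)"
    by (subst distributed_integrable[OF D, symmetric]) (use std_normal_abs_ln_moment(1) in auto)
  from G obtain s where "gaussian_hermitian M 1 s W"
    by (auto simp: GUE_matrix_def)
  then have [measurable]: "X_H 1 W \<in> borel_measurable M"
    by (rule gaussian_hermitian_X_H_measurable)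
  have "integrable M (\<lambda>\<omega>. \<bar>X_H 1 W \<omega>\<bar>)"
    using int by (subst Bochner_Integration.integrable_cong[OF refl, of _ _ "\<lambda>\<omega>. \<bar>ln \<bar>Re (W \<omega> $$ (0, 0))\<bar> - mu_H 1\<bar>"]) (auto simp: X)
  then show "integrable M (X_H 1 W)"
    by (subst (asm) integrable_abs_iff) auto
  have "(LINT \<omega>|M. \<bar>X_H 1 W \<omega>\<bar>) = (LINT \<omega>|M. \<bar>ln \<bar>Re (W \<omega> $$ (0, 0))\<bar> - mu_H 1\<bar>)"
    by (intro Bochner_Integration.integral_cong) (auto simp: X)
  also have "\<dots> = (LBINT x. std_normal_density x * \<bar>ln \<bar>x\<bar> - mu_H 1\<bar>)"
    by (rule distributed_integral[OF D, symmetric]) auto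
  also have "\<dots> \<le> 2"
    by (rule std_normal_abs_ln_moment)
  finally show "(LINT \<omega>|M. \<bar>X_H 1 W \<omega>\<bar>) \<le> 2" .
qed

lemma psi_n_H_imaginary:
  "psi_n_H M n W (\<i> * of_real u)
    = (CLINT \<omega>|M. iexp (u * X_H n W \<omega>)) * of_real (exp (u\<^sup>2 / 4 * ln (real n / 2)))"
  by (simp add: psi_n_H_def exp_of_real[symmetric] power_mult_distrib mult.assoc)

text \<open>
  The characteristic function of \<open>X_H 1 W\<close> differs from \<open>1\<close> by at most \<open>\<bar>u\<bar>\<close> times the first absolute
  moment, and the Gaussian factor \<open>exp (u\<^sup>2 / 4 * ln (1 / 2))\<close> by at most \<open>\<bar>u\<bar> / 4\<close>.
\<close>

lemma GUE_1_psi_bound: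
  assumes G: "GUE_matrix M 1 W" and u: "\<bar>u\<bar> \<le> 1"
  shows "cmod (psi_n_H M 1 W (\<i> * of_real u) - 1) \<le> 9 / 4 * \<bar>u\<bar>"
proof -
  note One_nat_def[simp del]
  interpret prob_space M using G by (simp add: GUE_matrix_def)
  have [measurable]: "X_H 1 W \<in> borel_measurable M"
    using GUE_1_X_H_moment(1)[OF G] by (rule borel_measurable_integrable)
  define \<phi> where "\<phi> = (CLINT \<omega>|M. iexp (u * X_H 1 W \<omega>))"
  define r where "r = exp (u\<^sup>2 / 4 * ln (1 / 2))"
  have int: "integrable M (\<lambda>\<omega>. iexp (u * X_H 1 W \<omega>))"
    by (rule integrable_const_bound[where B = 1]) auto
  have "\<phi> - 1 = (CLINT \<omega>|M. iexp (u * X_H 1 W \<omega>) - 1)"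
    unfolding \<phi>_def using int by (simp add: prob_space)
  also have "cmod \<dots> \<le> (LINT \<omega>|M. \<bar>u\<bar> * \<bar>X_H 1 W \<omega>\<bar>)"
  proof (rule order_trans[OF integral_norm_bound], rule integral_mono)
    show "integrable M (\<lambda>\<omega>. cmod (iexp (u * X_H 1 W \<omega>) - 1))"
      using int by (intro integrable_norm) auto
    show "integrable M (\<lambda>\<omega>. \<bar>u\<bar> * \<bar>X_H 1 W \<omega>\<bar>)"
      using GUE_1_X_H_moment(1)[OF G] by auto
    show "cmod (iexp (u * X_H 1 W \<omega>) - 1) \<le> \<bar>u\<bar> * \<bar>X_H 1 W \<omega>\<bar>" for \<omega>
      using iexp_approx1[of "u * X_H 1 W \<omega>" 0] by (simp add: abs_mult)
  qed
  also have "\<dots> \<le> \<bar>u\<bar> * 2"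
    using GUE_1_X_H_moment(2)[OF G] by (simp add: mult_left_mono)
  finally have \<phi>: "cmod (\<phi> - 1) \<le> 2 * \<bar>u\<bar>" by simp
  have ln: "ln (1 / 2 :: real) = - ln 2"
    by (simp add: ln_div)
  have r: "0 \<le> r" "r \<le> 1"
    by (simp_all add: r_def ln)
  have "u\<^sup>2 \<le> \<bar>u\<bar>"
    using u mult_left_le[of "\<bar>u\<bar>" "\<bar>u\<bar>"] by (simp add: power2_eq_square)
  moreover have "u\<^sup>2 * ln 2 \<le> u\<^sup>2 * 1"
    using ln_2_less_1 by (intro mult_left_mono) auto
  moreover have "1 + u\<^sup>2 / 4 * ln (1 / 2) \<le> r"
    unfolding r_def by (rule exp_ge_add_one_self)
  ultimately have r1: "1 - r \<le> \<bar>u\<bar> / 4"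
    unfolding ln by simp
  have "psi_n_H M 1 W (\<i> * of_real u) - 1 = (\<phi> - 1) * of_real r + of_real (r - 1)"
    unfolding psi_n_H_imaginary \<phi>_def[symmetric] by (simp add: r_def algebra_simps)
  also have "cmod \<dots> \<le> cmod (\<phi> - 1) * r + (1 - r)"
    using r by (intro order_trans[OF norm_triangle_ineq]) (simp add: norm_mult del: of_real_diff)
  also have "\<dots> \<le> cmod (\<phi> - 1) * 1 + (1 - r)"
    using r by (intro add_right_mono mult_left_mono) auto
  finally show ?thesis
    using \<phi> r1 by simp
qed

section \<open>Comparison with the normal law\<close>

lemma std_normal_cdf_lipschitz:
  assumes xy: "x \<le> y"
  shows "cdf std_normal_distribution y - cdf std_normal_distribution x \<le> 2 / 5 * (y - x)"
proof (cases "x < y")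
  case True
  interpret N: real_distribution std_normal_distribution
    by (rule real_dist_normal_dist)
  have "emeasure std_normal_distribution {x<..y}
      = (\<integral>\<^sup>+z. ennreal (std_normal_density z) * indicator {x<..y} z \<partial>lborel)"
    by (simp add: emeasure_density)
  also have "\<dots> \<le> (\<integral>\<^sup>+z. ennreal (2 / 5) * indicator {x<..y} z \<partial>lborel)"
    by (intro nn_integral_mono mult_right_mono ennreal_leI std_normal_density_le) auto
  also have "\<dots> = ennreal (2 / 5) * ennreal (y - x)"
    using xy by (subst nn_integral_cmult_indicator) auto
  also have "\<dots> = ennreal (2 / 5 * (y - x))"
    using xy by (intro ennreal_mult[symmetric]) auto
  finally have "measure std_normal_distribution {x<..y} \<le> 2 / 5 * (y - x)"
    using xy by (simp add: N.emeasure_eq_measure)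
  then show ?thesis
    using N.cdf_diff_eq[OF True] by simp
qed (use xy in simp)

text \<open>
  The factor \<open>exp (- z\<^sup>2 / 4 * ln (n / 2))\<close> in \<open>psi_n_H\<close> removes exactly the Gaussian part of the
  characteristic function; the rescaling turns that part into the standard normal one.
\<close>

lemma GUE_char:
  assumes G: "GUE_matrix M n W" and n: "n \<ge> 3"
  shows "char (distr M borel (\<lambda>\<omega>. X_H n W \<omega> * sqrt (2 / ln (real n / 2)))) t
    = psi_n_H M n W (\<i> * of_real (t * sqrt (2 / ln (real n / 2)))) * of_real (exp (- t\<^sup>2 / 2))"
proof -
  define s where "s = sqrt (2 / ln (real n / 2))"
  from G obtain \<sigma> where "gaussian_hermitian M n \<sigma> W"
    by (auto simp: GUE_matrix_def)
  then have [measurable]: "X_H n W \<in> borel_measurable M"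
    by (rule gaussian_hermitian_X_H_measurable)
  have ln: "ln (real n / 2) > 0"
    using n by (intro ln_gt_zero) auto
  then have "(t * s)\<^sup>2 / 4 * ln (real n / 2) = t\<^sup>2 / 2"
    by (simp add: s_def power_mult_distrib)
  then have "psi_n_H M n W (\<i> * of_real (t * s)) * of_real (exp (- t\<^sup>2 / 2))
      = (CLINT \<omega>|M. iexp (t * s * X_H n W \<omega>)) * of_real (exp (t\<^sup>2 / 2) * exp (- t\<^sup>2 / 2))"
    unfolding psi_n_H_imaginary by simp
  also have "exp (t\<^sup>2 / 2) * exp (- t\<^sup>2 / 2) = 1"
    by (simp flip: exp_add)
  also have "(CLINT \<omega>|M. iexp (t * s * X_H n W \<omega>)) * of_real 1
      = char (distr M borel (\<lambda>\<omega>. X_H n W \<omega> * s)) t"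
    unfolding char_def by (subst integral_distr) (auto simp: mult_ac)
  finally show ?thesis
    unfolding s_def by simp
qed

lemma cmod_exp_minus_1_le:
  fixes z :: complex
  shows "cmod (exp z - 1) \<le> cmod z * exp (cmod z)"
  using Taylor_exp_field[of z 0] by (simp add: mult.commute)

text \<open>
  Dividing the two comparisons with \<open>psi_H\<close> gives \<open>psi\<^sub>n = psi\<^sub>1 exp d\<close>. With \<open>\<bar>u\<bar> \<le> 1 / 2\<close> one has
  \<open>\<bar>u\<bar> + \<bar>u\<bar>\<^sup>2 + \<bar>u\<bar>\<^sup>3 \<le> 7 / 4 \<bar>u\<bar>\<close>, and \<open>n \<ge> 3\<close> gives the factor \<open>1 + 1 / n \<le> 4 / 3\<close>; together
  \<open>\<bar>d\<bar> \<le> 7 / 3 K \<bar>u\<bar> \<le> 7 / 6 K\<close>.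
\<close>

lemma psi_n_H_near_1:
  fixes K u :: real
  assumes K: "K > 0" and u: "\<bar>u\<bar> \<le> 1 / 2" and n: "n \<ge> 3"
    and G: "GUE_matrix M\<^sub>1 1 W\<^sub>1"
    and first: "exp l\<^sub>1 = psi_n_H M\<^sub>1 1 W\<^sub>1 (\<i> * of_real u)" "exp l = psi_H (\<i> * of_real u)"
      "cmod (l\<^sub>1 - l) \<le> K * ((\<bar>u\<bar> + \<bar>u\<bar> ^ 2 + \<bar>u\<bar> ^ 3) / real 1)"
    and nth: "exp l\<^sub>n = psi_n_H M n W (\<i> * of_real u)" "exp l' = psi_H (\<i> * of_real u)"
      "cmod (l\<^sub>n - l') \<le> K * ((\<bar>u\<bar> + \<bar>u\<bar> ^ 2 + \<bar>u\<bar> ^ 3) / real n)"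
  shows "cmod (psi_n_H M n W (\<i> * of_real u) - 1)
    \<le> (9 / 4 + 7 / 3 * K) * exp (7 / 6 * K) * \<bar>u\<bar>"
proof -
  define p where "p = psi_n_H M\<^sub>1 1 W\<^sub>1 (\<i> * of_real u)"
  define d where "d = (l\<^sub>n - l') - (l\<^sub>1 - l)"
  define S where "S = \<bar>u\<bar> + \<bar>u\<bar> ^ 2 + \<bar>u\<bar> ^ 3"
  have "exp d = (exp l\<^sub>n / exp l') / (exp l\<^sub>1 / exp l)"
    by (simp add: d_def exp_diff)
  then have eq: "psi_n_H M n W (\<i> * of_real u) = p * exp d"
    using first(1,2) nth(1,2) exp_not_eq_zero[of l] exp_not_eq_zero[of l\<^sub>1]
    by (simp add: p_def field_simps)
  have S: "0 \<le> S" "S \<le> 7 / 4 * \<bar>u\<bar>"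
  proof -
    have "\<bar>u\<bar> ^ 2 \<le> 1 / 2 * \<bar>u\<bar>"
      unfolding power2_eq_square using u by (intro mult_right_mono) auto
    moreover have "\<bar>u\<bar> ^ 3 \<le> 1 / 4 * \<bar>u\<bar>"
    proof -
      have "\<bar>u\<bar> ^ 2 \<le> (1 / 2) ^ 2"
        using u by (intro power_mono) auto
      then have "\<bar>u\<bar> ^ 2 * \<bar>u\<bar> \<le> 1 / 4 * \<bar>u\<bar>"
        by (intro mult_right_mono) (auto simp: power2_eq_square)
      then show ?thesis
        by (simp add: eval_nat_numeral mult_ac)
    qed
    ultimately show "S \<le> 7 / 4 * \<bar>u\<bar>"
      by (simp add: S_def)
  qed (simp add: S_def)
  have "cmod d \<le> cmod (l\<^sub>n - l') + cmod (l\<^sub>1 - l)"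
    unfolding d_def by (rule norm_triangle_ineq4)
  also have "\<dots> \<le> K * (S / real n) + K * (S / real 1)"
    using first(3) nth(3) by (intro add_mono) (auto simp: S_def)
  also have "\<dots> \<le> K * (S / 3) + K * (S / 1)"
    using K S(1) n by (intro add_mono mult_left_mono divide_left_mono) auto
  also have "\<dots> = K * (4 / 3 * S)"
    by (simp add: field_simps)
  also have "\<dots> \<le> K * (4 / 3 * (7 / 4 * \<bar>u\<bar>))"
    using K S by (intro mult_left_mono) auto
  finally have d: "cmod d \<le> 7 / 3 * K * \<bar>u\<bar>"
    by simp
  also have "\<dots> \<le> 7 / 3 * K * (1 / 2)"
    using K u by (intro mult_left_mono) auto
  finally have d': "exp (cmod d) \<le> exp (7 / 6 * K)"
    by simp
  have p: "cmod (p - 1) \<le> 9 / 4 * \<bar>u\<bar>"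
    unfolding p_def using u by (intro GUE_1_psi_bound[OF G]) auto
  have "psi_n_H M n W (\<i> * of_real u) - 1 = (p - 1) * exp d + (exp d - 1)"
    by (simp add: eq algebra_simps)
  then have "cmod (psi_n_H M n W (\<i> * of_real u) - 1) \<le> cmod (p - 1) * cmod (exp d) + cmod (exp d - 1)"
    by (metis norm_mult norm_triangle_ineq)
  also have "\<dots> \<le> (9 / 4 * \<bar>u\<bar>) * exp (7 / 6 * K) + (7 / 3 * K * \<bar>u\<bar>) * exp (7 / 6 * K)"
  proof (intro add_mono mult_mono p)
    show "cmod (exp d) \<le> exp (7 / 6 * K)"
      using norm_exp[of d] d' by linarith
    show "cmod (exp d - 1) \<le> (7 / 3 * K * \<bar>u\<bar>) * exp (7 / 6 * K)"
      using K by (intro order_trans[OF cmod_exp_minus_1_le] mult_mono d d') auto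
  qed auto
  finally show ?thesis
    by (simp add: algebra_simps)
qed

text \<open>
  The first summand is compared with the \<open>K\<close>-dependent part of \<open>C_const\<close>, using
  \<open>exp (3 K) = exp (7 / 6 K) exp (11 / 6 K)\<close> and \<open>exp (7 / 4) \<ge> 4\<close>, and \<open>96 / pi\<close> with the rest.
\<close>

lemma constant_comparison:
  fixes K :: real
  assumes K: "K > 0"
  shows "5 * ((9 / 4 + 7 / 3 * K) * exp (7 / 6 * K)) * sqrt (2 * pi) / pi + 96 / pi
    \<le> C_const (1 / 22) 1 ((3 + K) * exp (7 / 4 + 3 * K))"
proof -
  have e: "4 \<le> exp (7 / 4 :: real)"
    using exp_lower_Taylor_quadratic[of "7 / 4 :: real"] by (simp add: power2_eq_square)
  have "9 / 4 + 7 / 3 * K \<le> 4 / 5 * ((3 + K) * (1 + 11 / 6 * K))"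
  proof -
    have "0 \<le> K * K" by simp
    moreover have "(3 + K) * (1 + 11 / 6 * K) = 3 + 13 / 2 * K + 11 / 6 * (K * K)"
      by (simp add: field_simps)
    ultimately show ?thesis
      using K by linarith
  qed
  also have "\<dots> \<le> 4 / 5 * ((3 + K) * exp (11 / 6 * K))"
    using K exp_ge_add_one_self[of "11 / 6 * K"] by (intro mult_left_mono) auto
  finally have "5 * ((9 / 4 + 7 / 3 * K) * exp (7 / 6 * K))
      \<le> 5 * ((4 / 5 * ((3 + K) * exp (11 / 6 * K))) * exp (7 / 6 * K))"
    by (intro mult_left_mono mult_right_mono) auto
  also have "\<dots> = 4 * ((3 + K) * exp (3 * K))"
    by (simp add: mult.assoc flip: exp_add)
  also have "\<dots> \<le> exp (7 / 4) * ((3 + K) * exp (3 * K))"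
    using e K by (intro mult_right_mono) auto
  also have "\<dots> = (3 + K) * exp (7 / 4 + 3 * K)"
    by (simp add: exp_add)
  finally have k: "5 * ((9 / 4 + 7 / 3 * K) * exp (7 / 6 * K)) \<le> (3 + K) * exp (7 / 4 + 3 * K)" .
  have "sqrt 2 \<le> 3 / 2"
    by (rule real_le_lsqrt) (auto simp: power2_eq_square)
  then have sq: "sqrt (2 * pi) \<le> 3 / 2 * sqrt pi"
    by (simp add: real_sqrt_mult)
  have "1 \<le> sqrt (pi / 2)"
    using pi_approx by (intro real_le_rsqrt) auto
  then have "96 \<le> 231 * sqrt (pi / 2)"
    by linarith
  moreover have "5 * ((9 / 4 + 7 / 3 * K) * exp (7 / 6 * K)) * sqrt (2 * pi)
      \<le> ((3 + K) * exp (7 / 4 + 3 * K)) * (3 / 2 * sqrt pi)"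
    using K by (intro mult_mono[OF k sq]) auto
  ultimately have "5 * ((9 / 4 + 7 / 3 * K) * exp (7 / 6 * K)) * sqrt (2 * pi) + 96
    \<le> ((3 + K) * exp (7 / 4 + 3 * K)) * (3 / 2 * sqrt pi) + 231 * sqrt (pi / 2)"
    by linarith
  then have "(5 * ((9 / 4 + 7 / 3 * K) * exp (7 / 6 * K)) * sqrt (2 * pi) + 96) / pi
    \<le> (((3 + K) * exp (7 / 4 + 3 * K)) * (3 / 2 * sqrt pi) + 231 * sqrt (pi / 2)) / pi"
    by (intro divide_right_mono) auto
  also have "\<dots> = C_const (1 / 22) 1 ((3 + K) * exp (7 / 4 + 3 * K))"
    by (simp add: C_const_def Gamma_one_half_real field_simps)
  finally show ?thesis
    by (simp add: add_divide_distrib)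
qed

theorem theorem4p10:
  fixes M :: "nat \<Rightarrow> 'a measure" and W :: "nat \<Rightarrow> 'a \<Rightarrow> complex mat" and K :: real and n :: nat
  assumes GUE: "\<And>m. m \<ge> 1 \<Longrightarrow> GUE_matrix (M m) m (W m)"
    and K_pos: "K > 0"
    and K_bound: "\<And>m. m \<ge> 1 \<Longrightarrow>
      \<exists>L\<^sub>m L.
        is_log_branch {\<xi>. \<bar>\<xi>\<bar> \<le> 1 / 2 * real m powr (1 / 6)}
          (\<lambda>\<xi>. psi_n_H (M m) m (W m) (\<i> * of_real \<xi>)) L\<^sub>m \<and>
        is_log_branch {\<xi>. \<bar>\<xi>\<bar> \<le> 1 / 2 * real m powr (1 / 6)}
          (\<lambda>\<xi>. psi_H (\<i> * of_real \<xi>)) L \<and>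
        (\<forall>\<xi>. \<bar>\<xi>\<bar> \<le> 1 / 2 * real m powr (1 / 6) \<longrightarrow>
          cmod (L\<^sub>m \<xi> - L \<xi>) \<le> K * ((\<bar>\<xi>\<bar> + \<bar>\<xi>\<bar> ^ 2 + \<bar>\<xi>\<bar> ^ 3) / real m))"
    and n: "n \<ge> 3"
  shows "kolmogorov_distance
           (distr (M n) borel (\<lambda>\<omega>. X_H n (W n) \<omega> * sqrt (2 / ln (real n / 2))))
           std_normal_distribution
         \<le> C_const (1 / 22) 1 ((3 + K) * exp (7 / 4 + 3 * K)) * sqrt (2 / ln (real n / 2))"
proof -
  define s where "s = sqrt (2 / ln (real n / 2))"
  define \<kappa> where "\<kappa> = (9 / 4 + 7 / 3 * K) * exp (7 / 6 * K)"
  define \<mu> where "\<mu> = distr (M n) borel (\<lambda>\<omega>. X_H n (W n) \<omega> * s)"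
  define q where "q = (\<lambda>t. \<kappa> * s * sqrt (2 * pi) * std_normal_density t)"
  have s: "s > 0"
    using n by (auto simp: s_def intro!: divide_pos_pos ln_gt_zero)
  have \<kappa>: "\<kappa> > 0"
    using K_pos by (simp add: \<kappa>_def)
  have Gn: "GUE_matrix (M n) n (W n)"
    using GUE n by simp
  interpret P: prob_space "M n"
    using Gn by (simp add: GUE_matrix_def)
  obtain \<sigma> where "gaussian_hermitian (M n) n \<sigma> (W n)"
    using Gn by (auto simp: GUE_matrix_def)
  then have [measurable]: "X_H n (W n) \<in> borel_measurable (M n)"
    by (rule gaussian_hermitian_X_H_measurable)
  have \<mu>: "real_distribution \<mu>"
    unfolding \<mu>_def by (rule P.real_distribution_distr) measurable
  have psi: "cmod (psi_n_H (M n) n (W n) (\<i> * of_real u) - 1) \<le> \<kappa> * \<bar>u\<bar>" if u: "\<bar>u\<bar> \<le> 1 / 2" for u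
  proof -
    \<comment> \<open>the size-one bound limits the range: \<open>\<bar>u\<bar> \<le> 1 / 2\<close> is admissible for every \<open>m \<ge> 1\<close>\<close>
    have log: "\<exists>l\<^sub>m l. exp l\<^sub>m = psi_n_H (M m) m (W m) (\<i> * of_real u) \<and> exp l = psi_H (\<i> * of_real u)
        \<and> cmod (l\<^sub>m - l) \<le> K * ((\<bar>u\<bar> + \<bar>u\<bar> ^ 2 + \<bar>u\<bar> ^ 3) / real m)" if m: "m \<ge> 1" for m
    proof -
      have "1 \<le> real m powr (1 / 6)"
        using m by (intro ge_one_powr_ge_zero) auto
      then have "\<bar>u\<bar> \<le> 1 / 2 * real m powr (1 / 6)"
        using u by linarith
      then show ?thesis
        using K_bound[OF m] unfolding is_log_branch_def by blast
    qed
    obtain l\<^sub>1 l where "exp l\<^sub>1 = psi_n_H (M 1) 1 (W 1) (\<i> * of_real u)" "exp l = psi_H (\<i> * of_real u)"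
        "cmod (l\<^sub>1 - l) \<le> K * ((\<bar>u\<bar> + \<bar>u\<bar> ^ 2 + \<bar>u\<bar> ^ 3) / real 1)"
      using log[of 1] by blast
    moreover obtain l\<^sub>n l' where "exp l\<^sub>n = psi_n_H (M n) n (W n) (\<i> * of_real u)" "exp l' = psi_H (\<i> * of_real u)"
        "cmod (l\<^sub>n - l') \<le> K * ((\<bar>u\<bar> + \<bar>u\<bar> ^ 2 + \<bar>u\<bar> ^ 3) / real n)"
      using log[of n] n by auto
    ultimately show ?thesis
      unfolding \<kappa>_def by (intro psi_n_H_near_1[OF K_pos u n GUE[of 1]]) auto
  qed
  \<comment> \<open>cut-off \<open>T = 1 / (2 * s)\<close>, so that \<open>\<bar>t\<bar> \<le> T\<close> means \<open>\<bar>t * s\<bar> \<le> 1 / 2\<close>\<close>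
  have "(SUP x. \<bar>cdf \<mu> x - cdf std_normal_distribution x\<bar>)
      \<le> 5 * (LBINT t. q t) / pi + 120 * (2 / 5) / (pi * (1 / (2 * s)))"
  proof (rule kolmogorov_smoothing_inequality[OF \<mu> real_dist_normal_dist _ _ _ _ std_normal_cdf_lipschitz])
    show "integrable lborel q" "\<And>t. 0 \<le> q t"
      using s \<kappa> by (auto simp: q_def)
    fix t :: real assume t: "\<bar>t\<bar> \<le> 1 / (2 * s)"
    have "char \<mu> t - char std_normal_distribution t
        = (psi_n_H (M n) n (W n) (\<i> * of_real (t * s)) - 1) * of_real (exp (- t\<^sup>2 / 2))"
      unfolding \<mu>_def s_def GUE_char[OF Gn n] char_std_normal_distribution
      by (simp add: algebra_simps)
    also have "cmod \<dots> \<le> \<kappa> * \<bar>t * s\<bar> * exp (- t\<^sup>2 / 2)"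
      unfolding norm_mult using t s \<kappa>
      by (intro mult_mono psi) (auto simp: abs_mult field_simps)
    also have "\<dots> = \<bar>t\<bar> * q t"
      using s by (simp add: q_def std_normal_density_def abs_mult)
    finally show "cmod (char \<mu> t - char std_normal_distribution t) \<le> \<bar>t\<bar> * q t" .
  qed (use s in auto)
  also have "(LBINT t. q t) = \<kappa> * s * sqrt (2 * pi)"
    by (simp add: q_def)
  also have "5 * (\<kappa> * s * sqrt (2 * pi)) / pi + 120 * (2 / 5) / (pi * (1 / (2 * s)))
      = (5 * \<kappa> * sqrt (2 * pi) / pi + 96 / pi) * s"
    by (simp add: field_simps)
  also have "\<dots> \<le> C_const (1 / 22) 1 ((3 + K) * exp (7 / 4 + 3 * K)) * s"
    unfolding \<kappa>_def using s by (intro mult_right_mono constant_comparison K_pos) auto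
  finally show ?thesis
    by (simp add: kolmogorov_distance_def \<mu>_def s_def)
qed

end
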